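(* Let $\boldsymbol{B}\in\mathbb{R}^{n\times n}$ be an index matrix with diagonal elements $b_i=B_{ii}$ (so $b_1\geq\cdots\geq b_n$), let $\boldsymbol{g}=(g_1,\ldots,g_n)'\in R_{\boldsymbol{B}}$ and let $f\in GRV(\boldsymbol{g})$ with limit functions $\boldsymbol{h}$. For every $\varepsilon>0$ there exists $t(\varepsilon)>0$ such that $$\frac{|f(xt)-f(t)-\boldsymbol{h}(x)\boldsymbol{g}(t)|}{|g_n(t)|}\leq\begin{cases}\varepsilon\,x^{(b_1+\varepsilon)\vee0}&\text{if } t\geq t(\varepsilon)\text{ and }x\geq1;\\ \varepsilon\,x^{(b_n-\varepsilon)\wedge0}&\text{if } t\geq t(\varepsilon)\text{ and }t(\varepsilon)/t\leq x\leq1.\end{cases}$$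
   Context: Here $a\vee b=\max(a,b)$ and $a\wedge b=\min(a,b)$. Limit relations are as $t\to\infty$; measurability is Lebesgue. A real function is defined in a neighbourhood of infinity if its domain contains some $[t_0,\infty)$; it is eventually of constant sign if it is either strictly positive for all large $t$ or strictly negative for all large $t$. A rate vector of length $n$ is a column vector $\boldsymbol{g}=(g_1,\ldots,g_n)'$ of real-valued functions defined in a neighbourhood of infinity, each eventually of constant sign, with $g_{i+1}(t)=o(g_i(t))$ for every $i\in\{1,\ldots,n-1\}$; $o(g_n(t))$ means $o(|g_n(t)|)$, componentwise for vectors. For a square matrix $\boldsymbol{B}$ and $x>0$, $x^{\boldsymbol{B}}=\exp\{(\log x)\boldsymbol{B}\}$. An index matrix is an upper triangular $\boldsymbol{B}\in\mathbb{R}^{n\times n}$ whose diagonal elements are non-increasing and all of whose eigenvalues, except possibly the smallest one, have geometric multiplicity one. A rate vector $\boldsymbol{g}$ is regularly varying with index matrix $\boldsymbol{B}$, written $\boldsymbol{g}\in R_{\boldsymbol{B}}$, if $\boldsymbol{g}$ is measurable and $\boldsymbol{g}(xt)=x^{\boldsymbol{B}}\boldsymbol{g}(t)+o(g_n(t))$ for every $x\in(0,\infty)$. For $\boldsymbol{g}\in R_{\boldsymbol{B}}$, a measurable real-valued function $f$ defined in a neighbourhood of infinity is generalised regularly varying with rate vector $\boldsymbol{g}$ and $\boldsymbol{g}$-index $\boldsymbol{c}\in\mathbb{R}^{1\times n}$, written $f\in GRV(\boldsymbol{g})$, if for every $x\in(0,\infty)$, $f(xt)=f(t)+\boldsymbol{h}(x)\boldsymbol{g}(t)+o(g_n(t))$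 with $\boldsymbol{h}(x)=\boldsymbol{c}\int_1^x y^{\boldsymbol{B}}y^{-1}\,\mathrm{d}y$; the components of $\boldsymbol{h}$ are called the limit functions. *)

theory Defs
  imports
    "HOL-Analysis.Analysis"
    "HOL-Library.Landau_Symbols"
    "Jordan_Normal_Form.Char_Poly"
    "Jordan_Normal_Form.Matrix_Kernel"
begin

unbundle no vec_syntax
unbundle no inner_syntax

text \<open>
  Matrices and vectors are those of Jordan_Normal_Form, so indices start at 0: the components
  \<open>g\<^sub>1, \<dots>, g\<^sub>n\<close> of a rate vector are \<open>g t $ 0, \<dots>, g t $ (n - 1)\<close>.

  A function defined in a neighbourhood of infinity is a total function whose values on
  some initial part of the line are irrelevant. All notions below depend only on the values
  for large arguments.
\<close>

definition eventually_constant_sign :: "(real \<Rightarrow> real) \<Rightarrow> bool" where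
  "eventually_constant_sign u \<longleftrightarrow>
     eventually (\<lambda>t. u t > 0) at_top \<or> eventually (\<lambda>t. u t < 0) at_top"

definition measurable_near_infinity :: "(real \<Rightarrow> real) \<Rightarrow> bool" where
  "measurable_near_infinity u \<longleftrightarrow> (\<exists>t0. u \<in> borel_measurable (lebesgue_on {t0..}))"

definition rate_vector :: "nat \<Rightarrow> (real \<Rightarrow> real vec) \<Rightarrow> bool" where
  "rate_vector n g \<longleftrightarrow>
     (\<forall>t. g t \<in> carrier_vec n) \<and>
     (\<forall>i<n. eventually_constant_sign (\<lambda>t. g t $ i)) \<and>
     (\<forall>i. Suc i < n \<longrightarrow> (\<lambda>t. g t $ Suc i) \<in> o[at_top](\<lambda>t. g t $ i))"

text \<open>The matrix exponential; the matrix power series is summed entry by entry.\<close>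

definition mat_exp :: "real mat \<Rightarrow> real mat" where
  "mat_exp A = mat (dim_row A) (dim_col A) (\<lambda>(i, j). \<Sum>k. (A ^\<^sub>m k) $$ (i, j) / fact k)"

definition scalar_powr_mat :: "real \<Rightarrow> real mat \<Rightarrow> real mat" where
  "scalar_powr_mat x B = mat_exp (ln x \<cdot>\<^sub>m B)"

definition geometric_multiplicity :: "real mat \<Rightarrow> real \<Rightarrow> nat" where
  "geometric_multiplicity A l = kernel_dim (char_matrix A l)"

text \<open>
  An eigenvalue is not the smallest one iff some eigenvalue lies strictly below it. The
  eigenvalues of an upper triangular real matrix are its diagonal entries, so considering real
  eigenvalues loses nothing.
\<close>

definition index_matrix :: "nat \<Rightarrow> real mat \<Rightarrow> bool" where
  "index_matrix n B \<longleftrightarrow>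
     B \<in> carrier_mat n n \<and>
     upper_triangular B \<and>
     (\<forall>i j. i \<le> j \<and> j < n \<longrightarrow> B $$ (j, j) \<le> B $$ (i, i)) \<and>
     (\<forall>l. eigenvalue B l \<and> (\<exists>m. eigenvalue B m \<and> m < l) \<longrightarrow> geometric_multiplicity B l = 1)"

definition regularly_varying :: "nat \<Rightarrow> real mat \<Rightarrow> (real \<Rightarrow> real vec) \<Rightarrow> bool" where
  "regularly_varying n B g \<longleftrightarrow>
     rate_vector n g \<and>
     (\<forall>i<n. measurable_near_infinity (\<lambda>t. g t $ i)) \<and>
     (\<forall>x>0. \<forall>i<n.
        (\<lambda>t. g (x * t) $ i - (scalar_powr_mat x B *\<^sub>v g t) $ i) \<in> o[at_top](\<lambda>t. g t $ (n - 1)))"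

text \<open>
  The row vector \<open>h(x) = c \<integral>\<^sub>1\<^sup>x y\<^sup>B y\<^sup>-\<^sup>1 dy\<close>, as a \<open>1 \<times> n\<close> matrix. The integral is oriented: for
  \<open>x < 1\<close> it is minus the integral over \<open>[x, 1]\<close>.
\<close>

definition limit_functions :: "real mat \<Rightarrow> real mat \<Rightarrow> real \<Rightarrow> real mat" where
  "limit_functions B c x =
     c * mat (dim_row B) (dim_col B)
           (\<lambda>(i, j). LBINT y=ereal 1..ereal x. scalar_powr_mat y B $$ (i, j) * inverse y)"

text \<open>The \<open>1 \<times> 1\<close> product \<open>h(x) g(t)\<close> is read as a number by taking its only entry.\<close>

definition GRV ::
  "nat \<Rightarrow> real mat \<Rightarrow> (real \<Rightarrow> real vec) \<Rightarrow> real mat \<Rightarrow> (real \<Rightarrow> real) \<Rightarrow> bool" where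
  "GRV n B g c f \<longleftrightarrow>
     c \<in> carrier_mat 1 n \<and>
     measurable_near_infinity f \<and>
     (\<forall>x>0. (\<lambda>t. f (x * t) - f t - (limit_functions B c x *\<^sub>v g t) $ 0)
              \<in> o[at_top](\<lambda>t. g t $ (n - 1)))"

end

theory Submission
  imports Defs
begin

text \<open>
  In the variables \<open>s = ln t\<close> and \<open>u = ln x\<close> the two asymptotic relations say that the defects
  \<open>DG u s = G (s + u) - E u G s\<close> and \<open>DF u s = F (s + u) - F s - h u G s\<close>, with \<open>E u = exp (u B)\<close>,
  are \<open>o(r s)\<close> for each \<open>u\<close>, where \<open>r s = \<bar>g\<^sub>n(t)\<bar>\<close>. The cocycle identities of \<open>E\<close> and \<open>h\<close> give
  \<open>DG (u + v) s = DG v (s + u) + E v (DG u s)\<close> and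
  \<open>DF (u + v) s = DF v (s + u) + DF u s + h v (DG u s)\<close>. By measurability these relations force the
  convergence to be uniform for \<open>u \<in> [-1, 1]\<close>, first for \<open>ln r\<close> and then for the defects. Iterating
  them over unit steps gives the bounds: in a weighted norm the upper triangular matrices \<open>E (\<plusminus>1)\<close>
  have norm close to their largest diagonal entry, so all sums are dominated by geometric series.
\<close>

section \<open>Measurability and uniform convergence in logarithmic variables\<close>

text \<open>Continuity only controls preimages of Borel sets; for Lebesgue sets, null sets must pull
  back to null sets. The preimage is the image of \<open>A \<inter> {0<..}\<close> under the
  differentiable inverse \<open>ln t - s\<close>, and differentiable images of Lebesgue sets are
  Lebesgue.\<close>

lemma measurable_exp_translation:
  "(\<lambda>u::real. exp (s + u)) \<in> lebesgue \<rightarrow>\<^sub>M lebesgue"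
proof (rule measurableI)
  fix A :: "real set" assume "A \<in> sets lebesgue"
  then have A: "A \<inter> {0<..} \<in> sets lebesgue" by (intro sets.Int) auto
  have d: "(\<lambda>t. ln t - s) differentiable_on (A \<inter> {0<..})"
  proof (intro differentiable_on_subset[OF differentiable_on_diff])
    show "ln differentiable_on {0::real<..}"
      by (rule differentiable_at_imp_differentiable_on)
         (metis DERIV_ln greaterThan_iff real_differentiable_def)
  qed (auto simp: differentiable_on_def)
  have "(\<lambda>u. exp (s + u)) -` A = (\<lambda>t. ln t - s) ` (A \<inter> {0<..})"
  proof (intro Set.set_eqI iffI)
    fix u assume "u \<in> (\<lambda>u. exp (s + u)) -` A"
    then show "u \<in> (\<lambda>t. ln t - s) ` (A \<inter> {0<..})"
      by (intro image_eqI[of _ _ "exp (s + u)"]) auto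
  qed auto
  moreover have "(\<lambda>t. ln t - s) ` (A \<inter> {0<..}) \<in> sets lebesgue"
    using A d by (intro differentiable_image_in_sets_lebesgue) auto
  ultimately show "(\<lambda>u. exp (s + u)) -` A \<inter> space lebesgue \<in> sets lebesgue"
    by simp
qed auto

text \<open>The window \<open>{-2..2}\<close> has room for every sum \<open>u + v\<close> of two
  shifts from \<open>[-1, 1]\<close>, which the uniform convergence argument evaluates.\<close>

lemma measurable_near_infinity_exp_translation:
  fixes u :: "real \<Rightarrow> real"
  assumes "measurable_near_infinity u"
  shows "\<exists>S. \<forall>s\<ge>S. (\<lambda>v. u (exp (s + v))) \<in> borel_measurable (lebesgue_on {-2..2})"
proof -
  obtain t0 where t0: "u \<in> borel_measurable (lebesgue_on {t0..})"
    using assms by (auto simp: measurable_near_infinity_def)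
  show ?thesis
  \<comment> \<open>The summand 2 pays for the left end of the window, and \<open>max t0 1\<close>
    keeps the argument of the logarithm positive.\<close>
  proof (intro exI[of _ "ln (max t0 1) + 2"] allI impI)
    fix s assume s: "s \<ge> ln (max t0 1) + 2"
    have "(\<lambda>v. exp (s + v)) \<in> lebesgue_on {-2..2} \<rightarrow>\<^sub>M lebesgue_on {t0..}"
    proof (rule measurable_restrict_space3)
      show "(\<lambda>v. exp (s + v)) \<in> lebesgue \<rightarrow>\<^sub>M lebesgue" by (rule measurable_exp_translation)
      have "t0 \<le> exp (s + v)" if "v \<ge> -2" for v
      proof -
        have "t0 \<le> exp (ln (max t0 1))" by simp
        also have "\<dots> \<le> exp (s + v)" using s that by (intro exp_le_cancel_iff[THEN iffD2]) linarith
        finally show ?thesis .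
      qed
      then show "(\<lambda>v. exp (s + v)) \<in> {-2..2} \<rightarrow> {t0..}" by auto
    qed
    from measurable_compose[OF this t0]
    show "(\<lambda>v. u (exp (s + v))) \<in> borel_measurable (lebesgue_on {-2..2})" .
  qed
qed

text \<open>If \<open>N u s\<close> is large for one \<open>u\<close>, then for every \<open>v \<in> [-1, 1]\<close> one of \<open>N (u + v) s\<close> and
  \<open>N v (s + u)\<close> is large, so one of two sets whose measures tend to \<open>0\<close> has measure at least \<open>1\<close>.\<close>

lemma uniform_convergence_of_quasi_triangle:
  fixes N :: "real \<Rightarrow> real \<Rightarrow> real"
  assumes lim: "\<And>u. (N u \<longlongrightarrow> 0) at_top"
    and meas: "\<And>s. s \<ge> R \<Longrightarrow> (\<lambda>u. N u s) \<in> borel_measurable (lebesgue_on {-2..2})"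
    and tri: "\<And>s u v. s \<ge> R \<Longrightarrow> \<bar>u\<bar> \<le> 1 \<Longrightarrow> \<bar>v\<bar> \<le> 1 \<Longrightarrow> N u s \<le> C * (N (u + v) s + N v (s + u))"
    and "C > 0" "\<delta> > 0"
  shows "\<exists>S. \<forall>s\<ge>S. \<forall>u. \<bar>u\<bar> \<le> 1 \<longrightarrow> N u s \<le> \<delta>"
proof -
  \<comment> \<open>If \<open>N (u + v) s\<close> and \<open>N v (s + u)\<close> were both at most
    \<eta>, then \<open>tri\<close> would give
    \<open>N u s \<le> 2 * C * \<eta> = \<delta>\<close>.\<close>
  define \<eta> where "\<eta> = \<delta> / (2 * C)"
  have "\<eta> > 0" using assms by (simp add: \<eta>_def)
  define P where "P s = {u\<in>{-2..2}. N u s > \<eta>}" for s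
  have P_on: "P s \<in> sets (lebesgue_on {-2..2})" if "s \<ge> R" for s
  proof -
    have "{u \<in> space (lebesgue_on {-2..2}). N u s > \<eta>} \<in> sets (lebesgue_on {-2..2})"
      using meas[OF that] by (intro borel_measurable_less borel_measurable_const)
    then show ?thesis by (simp add: P_def)
  qed
  have P_sets: "P s \<in> sets lebesgue" if "s \<ge> R" for s
    using P_on[OF that] by (subst (asm) sets_restrict_space_iff) auto
  have P_lm: "P s \<in> lmeasurable" if "s \<ge> R" for s
  proof (rule bounded_set_imp_lmeasurable)
    have "P s \<subseteq> {-2..2}" by (auto simp: P_def)
    then show "bounded (P s)" using bounded_closed_interval bounded_subset by blast
  qed (rule P_sets[OF that])
  \<comment> \<open>Each fixed \<open>u\<close> eventually leaves \<open>P s\<close>, so the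
    indicators tend to 0, dominated by that of the window. Replacing \<open>s\<close> by
    \<open>max s R\<close> makes them measurable for every \<open>s\<close>, as dominated
    convergence demands.\<close>
  have "((\<lambda>s. LINT u|lebesgue. indicator (P (max s R)) u :: real) \<longlongrightarrow> (LINT (u::real)|lebesgue. (0::real))) at_top"
  proof (rule integral_dominated_convergence_at_top[where w = "indicator {-2..2::real}"])
    show "\<And>s. (\<lambda>u. indicator (P (max s R)) u :: real) \<in> borel_measurable lebesgue"
      using P_sets by (intro borel_measurable_indicator) auto
    show "integrable lebesgue (indicator {-2..2::real} :: real \<Rightarrow> real)"
      by (rule integrable_real_indicator) (auto simp: emeasure_lborel_Icc_eq)
    show "\<forall>\<^sub>F i in at_top. AE x in lebesgue. norm (indicator (P (max i R)) x :: real) \<le> (indicat_real {- 2..2} x)"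
      by (intro always_eventually allI AE_I2) (auto simp: P_def indicator_def)
    have "((\<lambda>s. indicator (P (max s R)) u :: real) \<longlongrightarrow> 0) at_top" for u
    proof (rule tendsto_eventually)
      have "eventually (\<lambda>s. N u s < \<eta>) at_top"
        using order_tendstoD(2)[OF lim \<open>\<eta> > 0\<close>] .
      then show "eventually (\<lambda>s. indicator (P (max s R)) u = (0::real)) at_top"
        using eventually_ge_at_top[of R]
        by eventually_elim (auto simp: P_def max_def)
    qed
    then show "AE x in lebesgue. ((\<lambda>s. indicator (P (max s R)) x) \<longlongrightarrow> (0::real)) at_top"
      by simp
  qed simp
  then have "((\<lambda>s. measure lebesgue (P (max s R))) \<longlongrightarrow> 0) at_top"
    by simp
  from order_tendstoD(2)[OF this, of 1]
  obtain S1 where S1: "\<And>s. s \<ge> S1 \<Longrightarrow> measure lebesgue (P (max s R)) < 1"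
    by (auto simp: eventually_at_top_linorder)
  \<comment> \<open>The extra 1 keeps \<open>s + u\<close> in the range where \<open>P\<close> has
    small measure.\<close>
  define S where "S = max R S1 + 1"
  have small: "measure lebesgue (P s) < 1" if "s \<ge> S - 1" for s
    using S1[of s] that by (simp add: S_def max_absorb1)
  show ?thesis
  proof (intro exI[of _ S] allI impI, rule ccontr)
    fix s u assume s: "s \<ge> S" and u: "\<bar>u\<bar> \<le> (1::real)" and "\<not> N u s \<le> \<delta>"
    then have big: "N u s > \<delta>" by simp
    have ge: "s \<ge> R" "s + u \<ge> R" "s \<ge> S - 1" "s + u \<ge> S - 1"
      using s u by (auto simp: S_def)
    \<comment> \<open>Shifting by \<open>u\<close> turns the condition on \<open>u + v\<close> into
      one on \<open>v\<close>. The left side has measure 2, while translation invariance leaves each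
      set on the right with measure below 1.\<close>
    have sub: "{-1..1} \<subseteq> (\<lambda>x. x - u) ` P s \<union> P (s + u)"
    proof
      fix v :: real assume "v \<in> {-1..1}"
      then have v: "\<bar>v\<bar> \<le> 1" by (simp add: abs_le_iff)
      have "\<delta> < C * (N (u + v) s + N v (s + u))"
        using tri[OF ge(1) u v] big by linarith
      moreover have "\<delta> = C * (\<eta> + \<eta>)" using \<open>C > 0\<close> by (simp add: \<eta>_def)
      ultimately have "N (u + v) s > \<eta> \<or> N v (s + u) > \<eta>"
        using \<open>C > 0\<close> by (simp, argo)
      then show "v \<in> (\<lambda>x. x - u) ` P s \<union> P (s + u)"
        using u v by (auto simp: P_def intro!: image_eqI[of _ _ "u + v"])
    qed
    have "measure lebesgue {-1..1::real} \<le> measure lebesgue ((\<lambda>x. x - u) ` P s \<union> P (s + u))"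
      using P_lm[OF ge(1)] P_lm[OF ge(2)] sub
      by (intro measure_mono_fmeasurable fmeasurable.Un measurable_translation_subtract) auto
    also have "\<dots> \<le> measure lebesgue ((\<lambda>x. x - u) ` P s) + measure lebesgue (P (s + u))"
      using P_lm[OF ge(1)] P_lm[OF ge(2)]
      by (intro measure_Un_le) (auto intro: measurable_translation_subtract fmeasurableD)
    also have "\<dots> < 2"
      using small[OF ge(3)] small[OF ge(4)] by (simp add: measure_translation_subtract)
    finally show False by simp
  qed
qed

section \<open>Scalar recursions and weighted norms\<close>

text \<open>Induction compares \<open>a\<close> with the solution
  \<open>c * (p ^ j - q ^ j) / (p - q)\<close> of \<open>x (Suc j) = p * x j + c * q ^ j\<close>,
  \<open>x 0 = 0\<close>. The gap \<open>q < p\<close> absorbs the factor \<open>k\<close> that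
  would arise at equal rates.\<close>

lemma recursive_inequality_bound:
  fixes a :: "nat \<Rightarrow> real"
  assumes "a 0 \<le> 0" and step: "\<And>j. j < k \<Longrightarrow> a (Suc j) \<le> m * a j + c * q ^ j"
    and "0 \<le> m" "m \<le> p" "0 \<le> q" "q < p" "0 \<le> c"
  shows "a k \<le> c / (p - q) * p ^ k"
proof -
  have "a j \<le> c / (p - q) * (p ^ j - q ^ j)" if "j \<le> k" for j
    using that
  proof (induction j)
    case 0
    then show ?case using assms(1) by simp
  next
    case (Suc j)
    have nn: "0 \<le> c / (p - q) * (p ^ j - q ^ j)"
      using assms by (intro mult_nonneg_nonneg) (auto intro: power_mono)
    have "a (Suc j) \<le> m * a j + c * q ^ j"
      using Suc.prems by (intro step) simp
    also have "m * a j \<le> m * (c / (p - q) * (p ^ j - q ^ j))"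
      using Suc assms by (intro mult_left_mono) auto
    also have "\<dots> \<le> p * (c / (p - q) * (p ^ j - q ^ j))"
      using nn assms by (intro mult_right_mono) auto
    also have "p * (c / (p - q) * (p ^ j - q ^ j)) + c * q ^ j = c / (p - q) * (p ^ Suc j - q ^ Suc j)"
      using \<open>q < p\<close> by (simp add: divide_simps) (simp add: algebra_simps)
    finally show ?case by simp
  qed
  from this[of k] have "a k \<le> c / (p - q) * (p ^ k - q ^ k)" by simp
  also have "\<dots> \<le> c / (p - q) * p ^ k"
    using assms by (intro mult_left_mono) auto
  finally show ?thesis .
qed

text \<open>With weights \<open>M ^ i\<close>, an entry above the diagonal counts at most
  \<open>1 / M\<close> of its size relative to the weight of its column. For large \<open>M\<close>
  the weighted l1 operator norm is therefore governed by the diagonal.\<close>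

lemma weights_for_upper_triangular:
  fixes A :: "nat \<Rightarrow> nat \<Rightarrow> real"
  assumes upper: "\<And>i j. j < i \<Longrightarrow> i < n \<Longrightarrow> A i j = 0"
    and diag: "\<And>i. i < n \<Longrightarrow> \<bar>A i i\<bar> \<le> a" and "a < a'"
  shows "\<exists>w. (\<forall>i. 1 \<le> w i) \<and> (\<forall>j<n. (\<Sum>i<n. w i * \<bar>A i j\<bar>) \<le> a' * w j)"
proof -
  define Q where "Q = (\<Sum>i<n. \<Sum>j<n. \<bar>A i j\<bar>)"
  \<comment> \<open>For \<open>j \<ge> 1\<close> this gives
    \<open>M ^ (j - 1) * Q \<le> M ^ j * (a' - a)\<close>, which bounds the part of column
    \<open>j\<close> above the diagonal.\<close>
  define M where "M = max 1 (Q / (a' - a))"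
  have M1: "M \<ge> 1" and "Q / (a' - a) \<le> M" by (auto simp: M_def)
  then have QM: "Q \<le> M * (a' - a)" using \<open>a < a'\<close> by (simp add: divide_simps)
  have "(\<Sum>i<n. M ^ i * \<bar>A i j\<bar>) \<le> a' * M ^ j" if j: "j < n" for j
  proof -
    have "(\<Sum>i<n. M ^ i * \<bar>A i j\<bar>) = (\<Sum>i\<in>{..<j} \<union> {j}. M ^ i * \<bar>A i j\<bar>)"
      using j upper by (intro sum.mono_neutral_right) (auto simp: not_less_eq)
    also have "\<dots> = (\<Sum>i<j. M ^ i * \<bar>A i j\<bar>) + M ^ j * \<bar>A j j\<bar>"
      by (subst sum.union_disjoint) auto
    also have "(\<Sum>i<j. M ^ i * \<bar>A i j\<bar>) \<le> M ^ j * (a' - a)"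
    proof (cases j)
      case 0
      then show ?thesis using \<open>a < a'\<close> by simp
    next
      case (Suc j')
      have "(\<Sum>i<j. M ^ i * \<bar>A i j\<bar>) \<le> (\<Sum>i<j. M ^ j' * \<bar>A i j\<bar>)"
        using M1 Suc by (intro sum_mono mult_right_mono power_increasing) auto
      also have "\<dots> = M ^ j' * (\<Sum>i<j. \<bar>A i j\<bar>)" by (simp add: sum_distrib_left)
      also have "(\<Sum>i<j. \<bar>A i j\<bar>) \<le> (\<Sum>i<n. \<bar>A i j\<bar>)"
        using j by (intro sum_mono2) auto
      also have "(\<Sum>i<n. \<bar>A i j\<bar>) \<le> Q"
        unfolding Q_def using j by (intro sum_mono member_le_sum) auto
      also note QM
      also have "M ^ j' * (M * (a' - a)) = M ^ j * (a' - a)" using Suc by simp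
      finally show ?thesis using M1 by (simp add: mult_left_mono)
    qed
    also have "M ^ j * \<bar>A j j\<bar> \<le> M ^ j * a"
      using M1 diag[OF j] by (intro mult_left_mono) auto
    finally show ?thesis by (simp add: algebra_simps)
  qed
  then show ?thesis using M1 by (intro exI[of _ "\<lambda>i. M ^ i"]) auto
qed

section \<open>Defects and their cocycle identities\<close>

text \<open>In the application \<open>E u\<close> is \<open>exp (u B)\<close>, \<open>h u\<close> is
  the row of limit functions at \<open>exp u\<close>, \<open>b\<close> is the diagonal of
  \<open>B\<close>, and \<open>G\<close>, \<open>F\<close> are \<open>g\<close>, \<open>f\<close> at
  \<open>exp s\<close>. Plain functions of indices keep matrix carriers out of the analytic
  argument.\<close>

locale generalised_regular_variation =
  fixes n :: nat and E :: "real \<Rightarrow> nat \<Rightarrow> nat \<Rightarrow> real" and h :: "real \<Rightarrow> nat \<Rightarrow> real"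
    and b :: "nat \<Rightarrow> real" and G :: "nat \<Rightarrow> real \<Rightarrow> real" and F :: "real \<Rightarrow> real"
  assumes n_pos: "n \<ge> 1"
    and E_add: "\<And>i j u v. i < n \<Longrightarrow> j < n \<Longrightarrow> E (u + v) i j = (\<Sum>l<n. E u i l * E v l j)"
    and E_0: "\<And>i j. i < n \<Longrightarrow> j < n \<Longrightarrow> E 0 i j = (if i = j then 1 else 0)"
    and E_upper: "\<And>i j u. j < i \<Longrightarrow> i < n \<Longrightarrow> E u i j = 0"
    and E_diag: "\<And>i u. i < n \<Longrightarrow> E u i i = exp (b i * u)"
    and E_cont: "\<And>i j. i < n \<Longrightarrow> j < n \<Longrightarrow> continuous_on UNIV (\<lambda>u. E u i j)"
    and h_add: "\<And>j u v. j < n \<Longrightarrow> h (u + v) j = h u j + (\<Sum>l<n. h v l * E u l j)"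
    and h_cont: "\<And>j. j < n \<Longrightarrow> continuous_on UNIV (\<lambda>u. h u j)"
    and G_meas: "\<And>i. i < n \<Longrightarrow>
      \<exists>S. \<forall>s\<ge>S. (\<lambda>v. G i (s + v)) \<in> borel_measurable (lebesgue_on {-2..2})"
    and F_meas: "\<exists>S. \<forall>s\<ge>S. (\<lambda>v. F (s + v)) \<in> borel_measurable (lebesgue_on {-2..2})"
    and G_nonzero: "eventually (\<lambda>s. G (n - 1) s \<noteq> 0) at_top"
    and G_lim: "\<And>i u. i < n \<Longrightarrow>
      ((\<lambda>s. (G i (s + u) - (\<Sum>j<n. E u i j * G j s)) / G (n - 1) s) \<longlongrightarrow> 0) at_top"
    and F_lim: "\<And>u. ((\<lambda>s. (F (s + u) - F s - (\<Sum>j<n. h u j * G j s)) / G (n - 1) s) \<longlongrightarrow> 0) at_top"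
begin

definition r :: "real \<Rightarrow> real" where "r s = \<bar>G (n - 1) s\<bar>"

definition DG :: "nat \<Rightarrow> real \<Rightarrow> real \<Rightarrow> real" where
  "DG i u s = G i (s + u) - (\<Sum>j<n. E u i j * G j s)"

definition DF :: "real \<Rightarrow> real \<Rightarrow> real" where
  "DF u s = F (s + u) - F s - (\<Sum>j<n. h u j * G j s)"

text \<open>Since \<open>DF_add\<close> couples the defect of \<open>F\<close> with those of
  \<open>G\<close>, all of them are summed into one quantity for the uniform convergence
  argument.\<close>

definition total :: "real \<Rightarrow> real \<Rightarrow> real" where
  "total u s = \<bar>DF u s\<bar> + (\<Sum>i<n. \<bar>DG i u s\<bar>)"

lemma DG_add:
  assumes "i < n"
  shows "DG i (u + v) s = DG i v (s + u) + (\<Sum>l<n. E v i l * DG l u s)"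
proof -
  have "(\<Sum>j<n. E (u + v) i j * G j s) = (\<Sum>j<n. \<Sum>l<n. E v i l * E u l j * G j s)"
    using E_add[OF assms, of _ v u] by (simp add: add.commute sum_distrib_right)
  also have "\<dots> = (\<Sum>l<n. \<Sum>j<n. E v i l * E u l j * G j s)" by (rule sum.swap)
  also have "\<dots> = (\<Sum>l<n. E v i l * (\<Sum>j<n. E u l j * G j s))"
    by (simp add: sum_distrib_left mult.assoc)
  finally show ?thesis
    by (simp add: DG_def right_diff_distrib sum_subtractf add.assoc)
qed

lemma DF_add: "DF (u + v) s = DF v (s + u) + DF u s + (\<Sum>l<n. h v l * DG l u s)"
proof -
  have "(\<Sum>j<n. h (u + v) j * G j s) = (\<Sum>j<n. h u j * G j s + (\<Sum>l<n. h v l * E u l j * G j s))"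
    by (intro sum.cong) (auto simp: h_add distrib_right sum_distrib_right)
  also have "\<dots> = (\<Sum>j<n. h u j * G j s) + (\<Sum>j<n. \<Sum>l<n. h v l * E u l j * G j s)"
    by (rule sum.distrib)
  also have "(\<Sum>j<n. \<Sum>l<n. h v l * E u l j * G j s) = (\<Sum>l<n. \<Sum>j<n. h v l * E u l j * G j s)"
    by (rule sum.swap)
  also have "\<dots> = (\<Sum>l<n. h v l * (\<Sum>j<n. E u l j * G j s))"
    by (simp add: sum_distrib_left mult.assoc)
  finally show ?thesis
    by (simp add: DF_def DG_def right_diff_distrib sum_subtractf add.assoc)
qed

text \<open>By \<open>DG_add\<close> the bracket is \<open>E v\<close> applied to the vector of the
  \<open>DG m u s\<close>, and \<open>E (- v)\<close> inverts \<open>E v\<close>. This recovers the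
  defect at \<open>u\<close> from those at \<open>u + v\<close> and \<open>v\<close>.\<close>

lemma DG_cancel:
  assumes "i < n"
  shows "DG i u s = (\<Sum>l<n. E (- v) i l * (DG l (u + v) s - DG l v (s + u)))"
proof -
  have "(\<Sum>l<n. E (- v) i l * (DG l (u + v) s - DG l v (s + u)))
      = (\<Sum>l<n. \<Sum>m<n. E (- v) i l * E v l m * DG m u s)"
    by (intro sum.cong) (auto simp: DG_add sum_distrib_left mult.assoc)
  also have "\<dots> = (\<Sum>m<n. \<Sum>l<n. E (- v) i l * E v l m * DG m u s)" by (rule sum.swap)
  also have "\<dots> = (\<Sum>m<n. E (- v + v) i m * DG m u s)"
    using E_add[OF assms, of _ "- v" v] by (simp add: sum_distrib_right del: add.left_inverse)
  also have "\<dots> = (\<Sum>m<n. if m = i then DG m u s else 0)"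
    using assms by (intro sum.cong) (auto simp: E_0)
  also have "\<dots> = DG i u s" using assms by simp
  finally show ?thesis by simp
qed

lemma DG_0: "i < n \<Longrightarrow> DG i 0 s = 0"
proof -
  assume i: "i < n"
  have "(\<Sum>j<n. E 0 i j * G j s) = (\<Sum>j<n. if j = i then G j s else 0)"
    using i by (intro sum.cong) (auto simp: E_0)
  then show ?thesis using i by (simp add: DG_def)
qed

lemma DF_0: "DF 0 s = 0"
proof -
  \<comment> \<open>At \<open>u = v = 0\<close> the identity \<open>h_add\<close> reads
    \<open>h 0 j = h 0 j + h 0 j\<close>, because \<open>E 0\<close> is the identity.\<close>
  have "h 0 j = 0" if "j < n" for j
  proof -
    have "(\<Sum>l<n. h 0 l * E 0 l j) = (\<Sum>l<n. if l = j then h 0 l else 0)"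
      using that by (intro sum.cong) (auto simp: E_0)
    then show ?thesis using h_add[OF that, of 0 0] that by simp
  qed
  then show ?thesis by (simp add: DF_def)
qed

text \<open>One continuous function dominates all entries, so a single compactness argument on
  \<open>[-1, 1]\<close> serves both \<open>E\<close> and \<open>h\<close>.\<close>

lemma coefficients_bounded:
  "\<exists>K>0. \<forall>u. \<bar>u\<bar> \<le> 1 \<longrightarrow> (\<forall>i<n. \<forall>j<n. \<bar>E u i j\<bar> \<le> K) \<and> (\<forall>j<n. \<bar>h u j\<bar> \<le> K)"
proof -
  define \<phi> where "\<phi> u = (\<Sum>i<n. \<Sum>j<n. \<bar>E u i j\<bar>) + (\<Sum>j<n. \<bar>h u j\<bar>)" for u
  have "continuous_on UNIV \<phi>"
    unfolding \<phi>_def by (intro continuous_intros E_cont h_cont) auto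
  then have "compact (\<phi> ` {-1..1})"
    by (intro compact_continuous_image) (auto intro: continuous_on_subset)
  then obtain K where "\<forall>y\<in>\<phi> ` {-1..1}. norm y \<le> K"
    using compact_imp_bounded bounded_iff by blast
  then have K: "\<And>u. u \<in> {-1..1} \<Longrightarrow> \<bar>\<phi> u\<bar> \<le> K" by auto
  show ?thesis
  proof (intro exI[of _ "max K 1"] conjI allI impI)
    fix u :: real and i j assume u: "\<bar>u\<bar> \<le> 1" and i: "i < n" and j: "j < n"
    have "\<bar>E u i j\<bar> \<le> (\<Sum>j<n. \<bar>E u i j\<bar>)" using j by (intro member_le_sum) auto
    also have "\<dots> \<le> (\<Sum>i<n. \<Sum>j<n. \<bar>E u i j\<bar>)"
      using i by (intro member_le_sum[of i _ "\<lambda>i. \<Sum>j<n. \<bar>E u i j\<bar>"]) (auto intro: sum_nonneg)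
    also have "\<dots> \<le> \<phi> u" by (auto simp: \<phi>_def intro: sum_nonneg)
    also have "\<dots> \<le> K" using K[of u] u by (auto simp: abs_le_iff)
    finally show "\<bar>E u i j\<bar> \<le> max K 1" by simp
  next
    fix u :: real and j assume u: "\<bar>u\<bar> \<le> 1" and j: "j < n"
    have "\<bar>h u j\<bar> \<le> (\<Sum>j<n. \<bar>h u j\<bar>)" using j by (intro member_le_sum) auto
    also have "\<dots> \<le> \<phi> u" by (auto simp: \<phi>_def intro!: sum_nonneg)
    also have "\<dots> \<le> K" using K[of u] u by (auto simp: abs_le_iff)
    finally show "\<bar>h u j\<bar> \<le> max K 1" by simp
  qed auto
qed

text \<open>The last row of an upper triangular matrix has only its diagonal entry, so the last
  component varies regularly on its own, with exponent \<open>b (n - 1)\<close>.\<close>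

lemma DG_last: "DG (n - 1) u s = G (n - 1) (s + u) - exp (b (n - 1) * u) * G (n - 1) s"
proof -
  have "(\<Sum>j<n. E u (n - 1) j * G j s) = (\<Sum>j\<in>{n - 1}. E u (n - 1) j * G j s)"
    using n_pos E_upper by (intro sum.mono_neutral_right) auto
  then show ?thesis using n_pos by (simp add: DG_def E_diag)
qed

section \<open>Uniform convergence for bounded shifts\<close>

lemma r_pos_eventually: "eventually (\<lambda>s. r s > 0) at_top"
  using G_nonzero by eventually_elim (simp add: r_def)

lemma measurable_eventually:
  "\<exists>S. \<forall>s\<ge>S. (\<lambda>v. F (s + v)) \<in> borel_measurable (lebesgue_on {-2..2}) \<and>
     (\<forall>i<n. (\<lambda>v. G i (s + v)) \<in> borel_measurable (lebesgue_on {-2..2}))"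
proof -
  have "eventually (\<lambda>s. \<forall>i\<in>{..<n}. (\<lambda>v. G i (s + v)) \<in> borel_measurable (lebesgue_on {-2..2})) at_top"
    using G_meas by (intro eventually_ball_finite) (auto simp: eventually_at_top_linorder)
  moreover have "eventually (\<lambda>s. (\<lambda>v. F (s + v)) \<in> borel_measurable (lebesgue_on {-2..2})) at_top"
    using F_meas by (auto simp: eventually_at_top_linorder)
  ultimately show ?thesis
    unfolding eventually_at_top_linorder[symmetric] by eventually_elim auto
qed

text \<open>The logarithmic defect is additive: its value at \<open>(u + v, s)\<close> is the sum of
  those at \<open>(u, s)\<close> and \<open>(v, s + u)\<close>. Hence the quasi-triangle inequality
  holds with constant 1.\<close>

lemma r_uniform:
  assumes "\<eta> > 0"
  shows "\<exists>S. \<forall>s\<ge>S. \<forall>u. \<bar>u\<bar> \<le> 1 \<longrightarrow> \<bar>ln (r (s + u)) - ln (r s) - b (n - 1) * u\<bar> \<le> \<eta>"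
proof -
  obtain S where S: "\<And>s i. s \<ge> S \<Longrightarrow> i < n \<Longrightarrow> (\<lambda>v. G i (s + v)) \<in> borel_measurable (lebesgue_on {-2..2})"
    using measurable_eventually by blast
  show ?thesis
  proof (rule uniform_convergence_of_quasi_triangle[where C = 1 and \<delta> = \<eta> and R = S
        and N = "\<lambda>u s. \<bar>ln (r (s + u)) - ln (r s) - b (n - 1) * u\<bar>"])
    fix u
    have "((\<lambda>s. DG (n - 1) u s / G (n - 1) s) \<longlongrightarrow> 0) at_top"
      unfolding DG_def using n_pos by (intro G_lim) auto
    from tendsto_add[OF this tendsto_const[of "exp (b (n - 1) * u)"]]
    have "((\<lambda>s. DG (n - 1) u s / G (n - 1) s + exp (b (n - 1) * u)) \<longlongrightarrow> exp (b (n - 1) * u)) at_top"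
      by simp
    moreover have "eventually (\<lambda>s. DG (n - 1) u s / G (n - 1) s + exp (b (n - 1) * u) =
        G (n - 1) (s + u) / G (n - 1) s) at_top"
      unfolding DG_last using G_nonzero by eventually_elim (simp add: diff_divide_distrib)
    ultimately have "((\<lambda>s. G (n - 1) (s + u) / G (n - 1) s) \<longlongrightarrow> exp (b (n - 1) * u)) at_top"
      using tendsto_cong by fast
    from tendsto_rabs[OF this]
    have "((\<lambda>s. r (s + u) / r s) \<longlongrightarrow> exp (b (n - 1) * u)) at_top"
      by (simp add: r_def)
    from tendsto_ln[OF this]
    have "((\<lambda>s. ln (r (s + u) / r s)) \<longlongrightarrow> b (n - 1) * u) at_top" by simp
    moreover have "eventually (\<lambda>s. ln (r (s + u) / r s) = ln (r (s + u)) - ln (r s)) at_top"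
    proof -
      have "filterlim (\<lambda>s. s + u) at_top at_top"
        using filterlim_tendsto_add_at_top[OF tendsto_const filterlim_ident, of u]
        by (simp add: add.commute)
      with r_pos_eventually have "eventually (\<lambda>s. r (s + u) > 0) at_top"
        by (rule eventually_compose_filterlim)
      with r_pos_eventually
      show ?thesis by eventually_elim (simp add: ln_div)
    qed
    ultimately have "((\<lambda>s. ln (r (s + u)) - ln (r s)) \<longlongrightarrow> b (n - 1) * u) at_top"
      using tendsto_cong by fast
    from tendsto_rabs[OF tendsto_diff[OF this tendsto_const[of "b (n - 1) * u"]]]
    show "((\<lambda>s. \<bar>ln (r (s + u)) - ln (r s) - b (n - 1) * u\<bar>) \<longlongrightarrow> 0) at_top" by simp
  next
    fix s assume "s \<ge> S"
    then have m: "(\<lambda>v. G (n - 1) (s + v)) \<in> borel_measurable (lebesgue_on {-2..2})"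
      using S n_pos by auto
    have [measurable]: "(\<lambda>v::real. v) \<in> borel_measurable (lebesgue_on {-2..2})"
      by (intro continuous_imp_measurable_on_sets_lebesgue continuous_on_id) auto
    show "(\<lambda>u. \<bar>ln (r (s + u)) - ln (r s) - b (n - 1) * u\<bar>) \<in> borel_measurable (lebesgue_on {-2..2})"
      unfolding r_def using m by measurable
  next
    fix s u v :: real
    show "\<bar>ln (r (s + u)) - ln (r s) - b (n - 1) * u\<bar>
      \<le> 1 * (\<bar>ln (r (s + (u + v))) - ln (r s) - b (n - 1) * (u + v)\<bar>
          + \<bar>ln (r (s + u + v)) - ln (r (s + u)) - b (n - 1) * v\<bar>)"
      by (simp add: algebra_simps)
  qed (use assms in auto)
qed

text \<open>\<open>DG_cancel\<close> bounds the \<open>DG\<close> terms, as \<open>E (- v)\<close>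
  is bounded for \<open>\<bar>v\<bar> \<le> 1\<close>; \<open>DF_add\<close> then bounds
  \<open>DF u s\<close> up to a coupling term that the \<open>DG\<close> terms control.\<close>

lemma total_quasi_triangle:
  "\<exists>C>0. \<forall>u v s. \<bar>v\<bar> \<le> 1 \<longrightarrow> total u s \<le> C * (total (u + v) s + total v (s + u))"
proof -
  obtain K where K: "K > 0" "\<And>u i j. \<bar>u\<bar> \<le> 1 \<Longrightarrow> i < n \<Longrightarrow> j < n \<Longrightarrow> \<bar>E u i j\<bar> \<le> K"
    "\<And>u j. \<bar>u\<bar> \<le> 1 \<Longrightarrow> j < n \<Longrightarrow> \<bar>h u j\<bar> \<le> K"
    using coefficients_bounded by blast
  \<comment> \<open>The factor \<open>n * K\<close> is the cost of the \<open>DG\<close> bound,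
    \<open>K + 1\<close> counts the coupling term and the \<open>DG\<close> terms themselves, and
    the leading 1 stands for the two \<open>DF\<close> defects.\<close>
  have "total u s \<le> (1 + (K + 1) * (n * K)) * (total (u + v) s + total v (s + u))"
    if v: "\<bar>v\<bar> \<le> 1" for u v s
  proof -
    define g where "g u s = (\<Sum>i<n. \<bar>DG i u s\<bar>)" for u s
    have g0: "0 \<le> g u s" for u s by (simp add: g_def sum_nonneg)
    have tot: "total u s = \<bar>DF u s\<bar> + g u s" for u s by (simp add: total_def g_def)
    have "\<bar>DG i u s\<bar> \<le> K * (g (u + v) s + g v (s + u))" if i: "i < n" for i
    proof -
      have "\<bar>DG i u s\<bar> \<le> (\<Sum>l<n. \<bar>E (- v) i l * (DG l (u + v) s - DG l v (s + u))\<bar>)"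
        unfolding DG_cancel[OF i, of u s v] by (rule sum_abs)
      also have "\<dots> \<le> (\<Sum>l<n. K * (\<bar>DG l (u + v) s\<bar> + \<bar>DG l v (s + u)\<bar>))"
        unfolding abs_mult using K v i by (intro sum_mono mult_mono) auto
      also have "\<dots> = K * (g (u + v) s + g v (s + u))"
        by (simp add: g_def sum_distrib_left sum.distrib distrib_left)
      finally show ?thesis .
    qed
    then have "g u s \<le> (\<Sum>i<n. K * (g (u + v) s + g v (s + u)))"
      unfolding g_def[of u s] by (intro sum_mono) auto
    then have g: "g u s \<le> n * K * (g (u + v) s + g v (s + u))" by (simp add: algebra_simps)
    have "\<bar>\<Sum>l<n. h v l * DG l u s\<bar> \<le> (\<Sum>l<n. \<bar>h v l * DG l u s\<bar>)" by (rule sum_abs)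
    also have "\<dots> \<le> (\<Sum>l<n. K * \<bar>DG l u s\<bar>)"
      unfolding abs_mult using K v by (intro sum_mono mult_mono) auto
    also have "\<dots> = K * g u s" by (simp add: g_def sum_distrib_left)
    finally have "\<bar>DF u s\<bar> \<le> \<bar>DF (u + v) s\<bar> + \<bar>DF v (s + u)\<bar> + K * g u s"
      using DF_add[of u v s] by linarith
    then have "total u s \<le> \<bar>DF (u + v) s\<bar> + \<bar>DF v (s + u)\<bar> + (K + 1) * g u s"
      unfolding tot by (simp add: algebra_simps)
    also have "(K + 1) * g u s \<le> (K + 1) * (n * K * (g (u + v) s + g v (s + u)))"
      using K g by (intro mult_left_mono) auto
    also have "\<dots> \<le> (K + 1) * (n * K) * (total (u + v) s + total v (s + u))"
      unfolding mult.assoc[symmetric] using K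
      by (intro mult_left_mono mult_nonneg_nonneg) (auto simp: tot)
    also have "\<bar>DF (u + v) s\<bar> + \<bar>DF v (s + u)\<bar> \<le> total (u + v) s + total v (s + u)"
      using g0[of "u + v" s] g0[of v "s + u"] by (simp add: tot)
    finally show ?thesis by (simp add: algebra_simps)
  qed
  moreover have "0 < 1 + (K + 1) * (n * K)" using K by (auto intro!: add_pos_nonneg)
  ultimately show ?thesis by blast
qed

lemma total_nonneg: "0 \<le> total u s"
  by (auto simp: total_def intro!: add_nonneg_nonneg sum_nonneg)

lemma r_pos:
  "\<exists>S. \<forall>s\<ge>S. r s > 0"
  using r_pos_eventually by (simp add: eventually_at_top_linorder)

lemma total_measurable:
  "\<exists>S. \<forall>s\<ge>S. (\<lambda>u. total u s) \<in> borel_measurable (lebesgue_on {-2..2})"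
proof -
  obtain S where S: "\<And>s. s \<ge> S \<Longrightarrow> (\<lambda>v. F (s + v)) \<in> borel_measurable (lebesgue_on {-2..2})"
    "\<And>s i. s \<ge> S \<Longrightarrow> i < n \<Longrightarrow> (\<lambda>v. G i (s + v)) \<in> borel_measurable (lebesgue_on {-2..2})"
    using measurable_eventually by blast
  have cont: "\<phi> \<in> borel_measurable (lebesgue_on {-2..2})" if "continuous_on UNIV \<phi>"
    for \<phi> :: "real \<Rightarrow> real"
    using that by (intro continuous_imp_measurable_on_sets_lebesgue) (auto intro: continuous_on_subset)
  have "(\<lambda>u. total u s) \<in> borel_measurable (lebesgue_on {-2..2})" if "s \<ge> S" for s
    unfolding total_def DF_def DG_def
    by (intro borel_measurable_add borel_measurable_abs borel_measurable_sum borel_measurable_diff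
        borel_measurable_times borel_measurable_const cont[OF E_cont] cont[OF h_cont] S that) auto
  then show ?thesis by blast
qed

text \<open>After division of the quasi-triangle inequality by \<open>r s\<close>, the defect at
  \<open>s + u\<close> has the wrong normalisation; \<open>r_uniform\<close> repairs this at the
  price of a constant factor.\<close>

lemma total_uniform:
  assumes "\<eta> > 0"
  shows "\<exists>S. \<forall>s\<ge>S. \<forall>u. \<bar>u\<bar> \<le> 1 \<longrightarrow> total u s \<le> \<eta> * r s"
proof -
  obtain C where C: "C > 0"
    "\<And>u v s. \<bar>v\<bar> \<le> 1 \<Longrightarrow> total u s \<le> C * (total (u + v) s + total v (s + u))"
    using total_quasi_triangle by blast
  obtain S1 where S1: "\<And>s. s \<ge> S1 \<Longrightarrow> r s > 0" using r_pos by blast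
  obtain S2 where S2: "\<And>s. s \<ge> S2 \<Longrightarrow> (\<lambda>u. total u s) \<in> borel_measurable (lebesgue_on {-2..2})"
    using total_measurable by blast
  obtain S3 where S3: "\<And>s u. s \<ge> S3 \<Longrightarrow> \<bar>u\<bar> \<le> 1 \<Longrightarrow>
      \<bar>ln (r (s + u)) - ln (r s) - b (n - 1) * u\<bar> \<le> 1"
    using r_uniform[of 1] by auto
  \<comment> \<open>Adding 1 to \<open>S1\<close> makes \<open>r (s + u)\<close> positive as
    well.\<close>
  define S where "S = max (S1 + 1) (max S2 S3)"
  \<comment> \<open>The logarithm of \<open>r (s + u) / r s\<close> differs from
    \<open>b (n - 1) * u\<close> by at most 1, so \<open>R\<close> bounds this quotient.\<close>
  define R where "R = exp (\<bar>b (n - 1)\<bar> + 1)"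
  have ratio: "r (s + u) \<le> R * r s" if s: "s \<ge> S" and u: "\<bar>u\<bar> \<le> 1" for s u
  proof -
    have pos: "r s > 0" "r (s + u) > 0" using S1 s u by (auto simp: S_def)
    have "b (n - 1) * u \<le> \<bar>b (n - 1)\<bar> * \<bar>u\<bar>" by (simp flip: abs_mult)
    also have "\<dots> \<le> \<bar>b (n - 1)\<bar>" using u by (simp add: mult_left_le)
    finally have "ln (r (s + u)) \<le> ln R + ln (r s)"
      using S3[of s u] s u by (simp add: S_def R_def)
    also have "\<dots> = ln (R * r s)" using pos by (simp add: ln_mult R_def)
    finally show ?thesis using pos by (simp add: R_def)
  qed
  have weighted: "x + R * y \<le> (1 + R) * (x + y)" if "0 \<le> x" "0 \<le> y" for x y
  proof -
    have "0 \<le> R * x" using that by (simp add: R_def)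
    then show ?thesis using that by (simp add: algebra_simps)
  qed
  have "\<exists>S. \<forall>s\<ge>S. \<forall>u. \<bar>u\<bar> \<le> 1 \<longrightarrow> total u s / r s \<le> \<eta>"
  proof (rule uniform_convergence_of_quasi_triangle[where C = "C * (1 + R)" and \<delta> = \<eta> and R = S
        and N = "\<lambda>u s. total u s / r s"])
    fix u
    have 1: "((\<lambda>s. \<bar>DF u s / G (n - 1) s\<bar>) \<longlongrightarrow> 0) at_top"
      unfolding DF_def by (intro tendsto_rabs_zero F_lim)
    have 2: "((\<lambda>s. \<Sum>i<n. \<bar>DG i u s / G (n - 1) s\<bar>) \<longlongrightarrow> 0) at_top"
      unfolding DG_def by (intro tendsto_null_sum tendsto_rabs_zero G_lim) auto
    show "((\<lambda>s. total u s / r s) \<longlongrightarrow> 0) at_top"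
      using tendsto_add[OF 1 2]
      by (simp add: total_def r_def add_divide_distrib sum_divide_distrib)
  next
    fix s assume "s \<ge> S"
    then show "(\<lambda>u. total u s / r s) \<in> borel_measurable (lebesgue_on {-2..2})"
      using S2 by (intro borel_measurable_divide borel_measurable_const) (auto simp: S_def)
  next
    fix s u v :: real assume s: "s \<ge> S" and u: "\<bar>u\<bar> \<le> 1" and v: "\<bar>v\<bar> \<le> 1"
    have pos: "r s > 0" "r (s + u) > 0" using S1 s u by (auto simp: S_def)
    have "total v (s + u) = (total v (s + u) / r (s + u)) * r (s + u)" using pos by simp
    also have "\<dots> \<le> (total v (s + u) / r (s + u)) * (R * r s)"
      using pos ratio[OF s u] total_nonneg by (intro mult_left_mono) auto
    finally have "total v (s + u) / r s \<le> R * (total v (s + u) / r (s + u))"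
      using pos by (simp add: divide_simps mult_ac)
    then have "total (u + v) s / r s + total v (s + u) / r s
        \<le> total (u + v) s / r s + R * (total v (s + u) / r (s + u))"
      by simp
    also have "\<dots> \<le> (1 + R) * (total (u + v) s / r s + total v (s + u) / r (s + u))"
      using pos total_nonneg by (intro weighted) auto
    finally have *: "total (u + v) s / r s + total v (s + u) / r s
      \<le> (1 + R) * (total (u + v) s / r s + total v (s + u) / r (s + u))" .
    have "total u s / r s \<le> C * (total (u + v) s + total v (s + u)) / r s"
      using C(2)[OF v] pos by (simp add: divide_right_mono)
    also have "\<dots> = C * (total (u + v) s / r s + total v (s + u) / r s)"
      by (simp only: add_divide_distrib[symmetric] times_divide_eq_right)
    also have "\<dots> \<le> C * ((1 + R) * (total (u + v) s / r s + total v (s + u) / r (s + u)))"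
      using * C by (intro mult_left_mono) auto
    finally show "total u s / r s \<le> C * (1 + R) * (total (u + v) s / r s + total v (s + u) / r (s + u))"
      by (simp add: mult.assoc)
  next
    show "C * (1 + R) > 0" using C by (simp add: R_def add_pos_pos)
  qed (rule assms)
  then obtain S4 where S4: "\<And>s u. s \<ge> S4 \<Longrightarrow> \<bar>u\<bar> \<le> 1 \<Longrightarrow> total u s / r s \<le> \<eta>" by blast
  show ?thesis
  proof (intro exI[of _ "max S1 S4"] allI impI)
    fix s u :: real assume "s \<ge> max S1 S4" "\<bar>u\<bar> \<le> 1"
    then show "total u s \<le> \<eta> * r s" using S1[of s] S4[of s u] by (simp add: divide_simps)
  qed
qed

section \<open>Bounds for unbounded shifts by iterated unit steps\<close>

text \<open>The sign \<open>d\<close> selects the direction, and \<open>exp \<beta>\<close> bounds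
  the diagonal of \<open>E d\<close>. Along unit steps from \<open>s\<close> to
  \<open>s + d * x\<close> the defects of \<open>G\<close> are bounded geometrically, while those of
  \<open>F\<close> accumulate additively, whence the cut-off of the exponent at 0.\<close>

lemma potter_direction:
  assumes d: "d = 1 \<or> d = -1" and \<beta>: "\<And>i. i < n \<Longrightarrow> d * b i \<le> \<beta>" and "\<epsilon> > 0"
  shows "\<exists>S. \<forall>s x. S \<le> s \<longrightarrow> 0 \<le> x \<longrightarrow> S \<le> s + d * x \<longrightarrow>
    \<bar>DF (d * x) s\<bar> \<le> \<epsilon> * exp (x * max (\<beta> + \<epsilon>) 0) * r s"
proof -
  \<comment> \<open>Three rates above \<open>exp \<beta>\<close>: \<open>q\<close> for one step of
    \<open>r\<close> and of the weighted norm, \<open>p\<close> after summing the \<open>DG\<close>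
    recursion, \<open>P\<close> after summing the \<open>DF\<close> recursion. The maximum with 0
    gives \<open>1 \<le> P\<close>, which a recursion with multiplier 1 requires.\<close>
  define q where "q = exp (\<beta> + \<epsilon> / 3)"
  define p where "p = exp (\<beta> + 2 * \<epsilon> / 3)"
  define P where "P = exp (max (\<beta> + \<epsilon>) 0)"
  have pq: "0 < q" "q < p" "p < P" "1 \<le> P" using \<open>\<epsilon> > 0\<close> by (auto simp: q_def p_def P_def)
  obtain K where K: "K > 0" "\<And>u j. \<bar>u\<bar> \<le> 1 \<Longrightarrow> j < n \<Longrightarrow> \<bar>h u j\<bar> \<le> K"
    using coefficients_bounded by blast
  have "\<exists>w. (\<forall>i. 1 \<le> w i) \<and> (\<forall>j<n. (\<Sum>i<n. w i * \<bar>E d i j\<bar>) \<le> q * w j)"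
  proof (rule weights_for_upper_triangular)
    show "\<bar>E d i i\<bar> \<le> exp \<beta>" if "i < n" for i
      using \<beta>[OF that] that by (simp add: E_diag mult.commute)
  qed (use E_upper \<open>\<epsilon> > 0\<close> in \<open>auto simp: q_def\<close>)
  then obtain w where w1: "\<And>i. 1 \<le> w i"
    and w: "\<And>j. j < n \<Longrightarrow> (\<Sum>i<n. w i * \<bar>E d i j\<bar>) \<le> q * w j" by blast
  define W where "W = (\<Sum>i<n. w i)"
  have w_nn: "0 \<le> w i" for i using w1[of i] by simp
  then have W0: "0 \<le> W" by (simp add: W_def sum_nonneg)
  \<comment> \<open>In units of \<open>\<eta> * r s\<close>, \<open>A\<close> is the factor of
    \<open>p ^ j\<close> in the \<open>DG\<close> bound after \<open>j\<close> steps, and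
    \<open>B\<close> below is the factor of \<open>P ^ k\<close> in the \<open>DF\<close> bound
    after \<open>k\<close> steps.\<close>
  define A where "A = W / (p - q)"
  have A0: "0 \<le> A" using W0 pq by (simp add: A_def)
  define B where "B = (1 + K * A) / (P - p)"
  have B0: "0 \<le> B" using A0 K pq by (simp add: B_def)
  \<comment> \<open>The final estimate consists of 1 for the fractional step, \<open>B\<close> for
    the unit steps and \<open>K * A\<close> for the coupling, each times \<eta>; the total is then
    exactly \<epsilon>.\<close>
  define \<eta> where "\<eta> = \<epsilon> / (1 + B + K * A)"
  have den: "0 < 1 + B + K * A" using A0 B0 K by (intro add_pos_nonneg) auto
  then have \<eta>: "\<eta> > 0" "\<eta> * (1 + B + K * A) = \<epsilon>" using \<open>\<epsilon> > 0\<close> by (auto simp: \<eta>_def)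
  obtain S1 where S1: "\<And>s. s \<ge> S1 \<Longrightarrow> r s > 0" using r_pos by blast
  obtain S2 where S2: "\<And>s u. s \<ge> S2 \<Longrightarrow> \<bar>u\<bar> \<le> 1 \<Longrightarrow>
      \<bar>ln (r (s + u)) - ln (r s) - b (n - 1) * u\<bar> \<le> \<epsilon> / 3"
    using r_uniform[of "\<epsilon> / 3"] \<open>\<epsilon> > 0\<close> by auto
  obtain S3 where S3: "\<And>s u. s \<ge> S3 \<Longrightarrow> \<bar>u\<bar> \<le> 1 \<Longrightarrow> total u s \<le> \<eta> * r s"
    using total_uniform[OF \<eta>(1)] by blast
  define S where "S = max (S1 + 1) (max S2 S3)"
  have DF_le: "\<bar>DF u s\<bar> \<le> \<eta> * r s" and DG_le: "i < n \<Longrightarrow> \<bar>DG i u s\<bar> \<le> \<eta> * r s"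
    if "s \<ge> S" "\<bar>u\<bar> \<le> 1" for s u i
  proof -
    have t: "total u s \<le> \<eta> * r s" using S3 that by (simp add: S_def)
    have "0 \<le> (\<Sum>i<n. \<bar>DG i u s\<bar>)" by (simp add: sum_nonneg)
    then show "\<bar>DF u s\<bar> \<le> \<eta> * r s" using t unfolding total_def by linarith
    show "\<bar>DG i u s\<bar> \<le> \<eta> * r s" if "i < n"
    proof -
      have "\<bar>DG i u s\<bar> \<le> (\<Sum>i<n. \<bar>DG i u s\<bar>)" using that by (intro member_le_sum) auto
      then show ?thesis using t unfolding total_def by linarith
    qed
  qed
  have abs_d: "\<bar>d\<bar> = 1" using d by auto
  \<comment> \<open>The exponent \<open>b (n - 1) * d \<le> \<beta>\<close> and the uniform error
    \<open>\<epsilon> / 3\<close> add up to at most \<open>ln q\<close>.\<close>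
  have r_step: "r (s + d) \<le> q * r s" if s: "s \<ge> S" for s
  proof -
    have pos: "r s > 0" "r (s + d) > 0" using S1 s d by (auto simp: S_def)
    have "b (n - 1) * d \<le> \<beta>" using \<beta>[of "n - 1"] n_pos by (simp add: mult.commute)
    moreover have "\<bar>ln (r (s + d)) - ln (r s) - b (n - 1) * d\<bar> \<le> \<epsilon> / 3"
      using S2[of s d] s abs_d by (simp add: S_def)
    ultimately have "ln (r (s + d)) \<le> ln q + ln (r s)"
      unfolding q_def ln_exp by linarith
    also have "\<dots> = ln (q * r s)" using pos pq by (simp add: ln_mult)
    finally show ?thesis using pos pq by simp
  qed
  define D where "D u s = (\<Sum>i<n. w i * \<bar>DG i u s\<bar>)" for u s
  have D_ge: "(\<Sum>i<n. \<bar>DG i u s\<bar>) \<le> D u s" for u s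
    unfolding D_def using w1 by (intro sum_mono) (simp add: mult_le_cancel_right1)
  have h_le: "\<bar>\<Sum>l<n. h v l * DG l u s\<bar> \<le> K * D u s" if v: "\<bar>v\<bar> \<le> 1" for u v s
  proof -
    have "\<bar>\<Sum>l<n. h v l * DG l u s\<bar> \<le> (\<Sum>l<n. \<bar>h v l * DG l u s\<bar>)" by (rule sum_abs)
    also have "\<dots> \<le> (\<Sum>l<n. K * \<bar>DG l u s\<bar>)"
      unfolding abs_mult using K v by (intro sum_mono mult_right_mono) auto
    also have "\<dots> = K * (\<Sum>l<n. \<bar>DG l u s\<bar>)" by (simp add: sum_distrib_left)
    also have "\<dots> \<le> K * D u s" using D_ge K by (intro mult_left_mono) auto
    finally show ?thesis .
  qed
  \<comment> \<open>The weights make \<open>E d\<close> expand \<open>D\<close> by at most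
    \<open>q\<close>; the new step adds one fresh defect, at most \<open>\<eta> * r (s + u)\<close>
    in each component.\<close>
  have D_step: "D (u + d) s \<le> q * D u s + W * (\<eta> * r (s + u))" if su: "s + u \<ge> S" for u s
  proof -
    have "D (u + d) s \<le> (\<Sum>i<n. w i * (\<eta> * r (s + u)) + (\<Sum>l<n. w i * \<bar>E d i l\<bar> * \<bar>DG l u s\<bar>))"
      unfolding D_def
    proof (intro sum_mono)
      fix i assume "i \<in> {..<n}"
      then have i: "i < n" by simp
      have "\<bar>DG i (u + d) s\<bar> \<le> \<bar>DG i d (s + u)\<bar> + (\<Sum>l<n. \<bar>E d i l\<bar> * \<bar>DG l u s\<bar>)"
        unfolding DG_add[OF i] abs_mult[symmetric]
        by (intro order_trans[OF abs_triangle_ineq] add_left_mono sum_abs)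
      also have "\<bar>DG i d (s + u)\<bar> \<le> \<eta> * r (s + u)" using DG_le su i abs_d by simp
      finally have "w i * \<bar>DG i (u + d) s\<bar> \<le> w i * (\<eta> * r (s + u) + (\<Sum>l<n. \<bar>E d i l\<bar> * \<bar>DG l u s\<bar>))"
        using w_nn by (intro mult_left_mono) auto
      then show "w i * \<bar>DG i (u + d) s\<bar> \<le> w i * (\<eta> * r (s + u)) + (\<Sum>l<n. w i * \<bar>E d i l\<bar> * \<bar>DG l u s\<bar>)"
        by (simp add: distrib_left sum_distrib_left mult.assoc)
    qed
    also have "\<dots> = W * (\<eta> * r (s + u)) + (\<Sum>i<n. \<Sum>l<n. w i * \<bar>E d i l\<bar> * \<bar>DG l u s\<bar>)"
      by (simp add: sum.distrib W_def sum_distrib_right)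
    also have "(\<Sum>i<n. \<Sum>l<n. w i * \<bar>E d i l\<bar> * \<bar>DG l u s\<bar>) = (\<Sum>l<n. (\<Sum>i<n. w i * \<bar>E d i l\<bar>) * \<bar>DG l u s\<bar>)"
      by (subst sum.swap) (simp add: sum_distrib_right)
    also have "\<dots> \<le> (\<Sum>l<n. q * w l * \<bar>DG l u s\<bar>)"
      using w by (intro sum_mono mult_right_mono) auto
    also have "\<dots> = q * D u s" by (simp add: D_def sum_distrib_left mult.assoc)
    finally show ?thesis by simp
  qed
  have "\<bar>DF (d * x) s\<bar> \<le> \<epsilon> * exp (x * max (\<beta> + \<epsilon>) 0) * r s"
    if s: "S \<le> s" and x: "0 \<le> x" and sx: "S \<le> s + d * x" for s x
  proof -
    define k where "k = nat \<lfloor>x\<rfloor>"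
    have k: "real k \<le> x" "x < real k + 1" using x by (auto simp: k_def)
    \<comment> \<open>Intermediate points lie between \<open>s\<close> and \<open>s + d * x\<close>;
      for \<open>d = -1\<close> the bound at the far endpoint is the decisive one.\<close>
    have sj: "S \<le> s + d * real j" if "j \<le> k" for j
    proof -
      have "real j \<le> x" using that k by linarith
      then show ?thesis using d s sx by auto
    qed
    have rs: "r s > 0" using S1 s by (auto simp: S_def)
    have r_le: "r (s + d * real j) \<le> q ^ j * r s" if "j \<le> k" for j
      using that
    proof (induction j)
      case (Suc j)
      have "r (s + d * real (Suc j)) = r (s + d * real j + d)" by (simp add: algebra_simps)
      also have "\<dots> \<le> q * r (s + d * real j)" using Suc.prems by (intro r_step sj) simp
      also have "\<dots> \<le> q * (q ^ j * r s)" using Suc pq by (intro mult_left_mono) auto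
      finally show ?case by (simp add: mult.assoc)
    qed simp
    \<comment> \<open>Multiplier and forcing term both have rate \<open>q\<close>; passing to the
      larger rate \<open>p\<close> avoids a factor \<open>j\<close>.\<close>
    have D_le: "D (d * real j) s \<le> \<eta> * A * r s * p ^ j" if j: "j \<le> k" for j
    proof -
      have "D (d * real j) s \<le> W * \<eta> * r s / (p - q) * p ^ j"
      proof (rule recursive_inequality_bound[where m = q and q = q and a = "\<lambda>j. D (d * real j) s"])
        fix i assume "i < j"
        then have i: "i \<le> k" using j by simp
        have "D (d * real (Suc i)) s = D (d * real i + d) s" by (simp add: algebra_simps)
        also have "\<dots> \<le> q * D (d * real i) s + W * (\<eta> * r (s + d * real i))"
          using sj[OF i] by (rule D_step)
        also have "W * (\<eta> * r (s + d * real i)) \<le> W * (\<eta> * (q ^ i * r s))"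
          using W0 \<eta> r_le[OF i] by (intro mult_left_mono) auto
        finally show "D (d * real (Suc i)) s \<le> q * D (d * real i) s + W * \<eta> * r s * q ^ i"
          by (simp add: mult_ac)
      qed (use pq W0 \<eta> rs in \<open>auto simp: D_def DG_0\<close>)
      then show ?thesis by (simp add: A_def mult_ac)
    qed
    \<comment> \<open>The multiplier is 1 because \<open>DF_add\<close> carries the old defect over
      unchanged. Each step adds a fresh \<open>DF\<close> defect and the coupling to
      \<open>D\<close>.\<close>
    have DF_k: "\<bar>DF (d * real k) s\<bar> \<le> \<eta> * (1 + K * A) * r s / (P - p) * P ^ k"
    proof (rule recursive_inequality_bound[where m = 1 and q = p and a = "\<lambda>j. \<bar>DF (d * real j) s\<bar>"])
      fix j assume "j < k"
      then have j: "j \<le> k" by simp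
      have "q ^ j * r s \<le> p ^ j * r s"
        using pq rs by (intro mult_right_mono power_mono) auto
      then have rj: "r (s + d * real j) \<le> p ^ j * r s" using r_le[OF j] by linarith
      have "DF (d * real (Suc j)) s = DF (d * real j + d) s" by (simp add: algebra_simps)
      also have "\<bar>\<dots>\<bar> \<le> \<bar>DF d (s + d * real j)\<bar> + \<bar>DF (d * real j) s\<bar> + K * D (d * real j) s"
        unfolding DF_add using h_le[of d "d * real j" s] abs_d by linarith
      also have "\<bar>DF d (s + d * real j)\<bar> \<le> \<eta> * r (s + d * real j)"
        using sj[OF j] abs_d by (intro DF_le) auto
      also have "\<eta> * r (s + d * real j) \<le> \<eta> * (p ^ j * r s)"
        using rj \<eta> by (intro mult_left_mono) auto
      also have "K * D (d * real j) s \<le> K * (\<eta> * A * r s * p ^ j)"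
        using D_le[OF j] K by (intro mult_left_mono) auto
      finally show "\<bar>DF (d * real (Suc j)) s\<bar> \<le> 1 * \<bar>DF (d * real j) s\<bar> + \<eta> * (1 + K * A) * r s * p ^ j"
        by (simp add: algebra_simps)
    qed (use pq A0 K \<eta> rs in \<open>auto simp: DF_0\<close>)
    \<comment> \<open>The remaining fractional step has length at most 1, so the uniform bounds
      apply to it at \<open>s + d * real k\<close>.\<close>
    define \<theta> where "\<theta> = d * (x - real k)"
    have \<theta>: "\<bar>\<theta>\<bar> \<le> 1" "d * x = d * real k + \<theta>"
      unfolding \<theta>_def abs_mult abs_d using k by (simp, simp add: algebra_simps)
    have "q ^ k * r s \<le> P ^ k * r s"
      using pq rs by (intro mult_right_mono power_mono) auto
    then have rk: "r (s + d * real k) \<le> P ^ k * r s" using r_le[of k] by linarith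
    have "\<bar>DF (d * x) s\<bar> \<le> \<bar>DF \<theta> (s + d * real k)\<bar> + \<bar>DF (d * real k) s\<bar> + K * D (d * real k) s"
      unfolding \<theta>(2) DF_add using h_le[OF \<theta>(1), of "d * real k" s] by linarith
    also have "\<bar>DF \<theta> (s + d * real k)\<bar> \<le> \<eta> * r (s + d * real k)"
      using sj[of k] \<theta>(1) by (intro DF_le) auto
    also have "\<eta> * r (s + d * real k) \<le> \<eta> * (P ^ k * r s)"
      using rk \<eta> by (intro mult_left_mono) auto
    also have "K * D (d * real k) s \<le> K * (\<eta> * A * r s * p ^ k)"
      using D_le[of k] K by (intro mult_left_mono) auto
    also have "K * (\<eta> * A * r s * p ^ k) \<le> K * (\<eta> * A * r s * P ^ k)"
      using pq A0 K \<eta> rs by (intro mult_left_mono power_mono mult_nonneg_nonneg) auto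
    also note DF_k
    also have "\<eta> * (P ^ k * r s) + \<eta> * (1 + K * A) * r s / (P - p) * P ^ k + K * (\<eta> * A * r s * P ^ k)
        = \<eta> * (1 + B + K * A) * P ^ k * r s"
      by (simp add: B_def algebra_simps)
    also have "\<dots> = \<epsilon> * P ^ k * r s" by (simp add: \<eta>(2))
    also have "P ^ k = exp (real k * max (\<beta> + \<epsilon>) 0)" by (simp add: P_def exp_of_nat_mult)
    \<comment> \<open>The rate is nonnegative, so replacing \<open>k\<close> by
      \<open>x \<ge> k\<close> only enlarges the bound.\<close>
    also have "\<epsilon> * \<dots> * r s \<le> \<epsilon> * exp (x * max (\<beta> + \<epsilon>) 0) * r s"
      using k rs \<open>\<epsilon> > 0\<close> by (intro mult_right_mono mult_left_mono) (auto intro: mult_right_mono)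
    finally show ?thesis by simp
  qed
  then show ?thesis by blast
qed

end

section \<open>Powers and exponential of a matrix\<close>

lemma index_mult_mat_sum:
  assumes "A \<in> carrier_mat n n" "B \<in> carrier_mat n n" "i < n" "j < n"
  shows "(A * B) $$ (i, j) = (\<Sum>l<n. A $$ (i, l) * B $$ (l, j))"
  using assms by (auto simp: scalar_prod_def lessThan_atLeast0 intro!: sum.cong)

lemma pow_mat_add:
  assumes "(A :: 'a :: semiring_1 mat) \<in> carrier_mat n n"
  shows "A ^\<^sub>m (p + q) = A ^\<^sub>m p * A ^\<^sub>m q"
proof (induction q)
  case 0
  then show ?case using assms right_mult_one_mat[of "A ^\<^sub>m p" n n] by simp
next
  case (Suc q)
  then show ?case
    using assms assoc_mult_mat[of "A ^\<^sub>m p" n n "A ^\<^sub>m q" n A n] by simp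
qed

lemma smult_pow_mat:
  assumes "(A :: 'a :: comm_semiring_1 mat) \<in> carrier_mat n n"
  shows "(c \<cdot>\<^sub>m A) ^\<^sub>m k = c ^ k \<cdot>\<^sub>m (A ^\<^sub>m k)"
proof (induction k)
  case 0
  then show ?case using assms by (intro eq_matI) auto
next
  case (Suc k)
  have "(c \<cdot>\<^sub>m A) ^\<^sub>m Suc k = (c ^ k \<cdot>\<^sub>m (A ^\<^sub>m k)) * (c \<cdot>\<^sub>m A)" using Suc by simp
  also have "\<dots> = c ^ k \<cdot>\<^sub>m (c \<cdot>\<^sub>m (A ^\<^sub>m k * A))"
    using assms mult_smult_assoc_mat[of "A ^\<^sub>m k" n n "c \<cdot>\<^sub>m A" n "c ^ k"]
      mult_smult_distrib[of "A ^\<^sub>m k" n n A n c] by simp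
  also have "\<dots> = c ^ Suc k \<cdot>\<^sub>m (A ^\<^sub>m Suc k)"
    using assms by (intro eq_matI) (auto simp: mult_ac)
  finally show ?case .
qed

lemma pow_mat_upper_triangular:
  assumes A: "(A :: 'a :: semiring_1 mat) \<in> carrier_mat n n" and "upper_triangular A"
  shows "(\<forall>i<n. \<forall>j<i. (A ^\<^sub>m k) $$ (i, j) = 0) \<and> (\<forall>i<n. (A ^\<^sub>m k) $$ (i, i) = (A $$ (i, i)) ^ k)"
proof (induction k)
  case (Suc k)
  have zero: "A $$ (i, j) = 0" if "j < i" "i < n" for i j
    using assms that by (auto dest: upper_triangularD)
  have entry: "(A ^\<^sub>m Suc k) $$ (i, j) = (\<Sum>l<n. (A ^\<^sub>m k) $$ (i, l) * A $$ (l, j))"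
    if "i < n" "j < n" for i j
    using A that index_mult_mat_sum[of "A ^\<^sub>m k" n A i j] by simp
  have "(A ^\<^sub>m Suc k) $$ (i, j) = 0" if "j < i" "i < n" for i j
  proof -
    \<comment> \<open>For \<open>l < i\<close> the entry of the power vanishes by induction;
      otherwise \<open>j < i \<le> l\<close> and the entry of \<open>A\<close> vanishes.\<close>
    have "(A ^\<^sub>m k) $$ (i, l) * A $$ (l, j) = 0" if "l < n" for l
      using Suc zero \<open>j < i\<close> \<open>i < n\<close> that by (cases "l < i") auto
    then show ?thesis using that by (subst entry) (auto intro!: sum.neutral)
  qed
  moreover have "(A ^\<^sub>m Suc k) $$ (i, i) = (A $$ (i, i)) ^ Suc k" if "i < n" for i
  proof -
    have "(\<Sum>l<n. (A ^\<^sub>m k) $$ (i, l) * A $$ (l, i)) = (\<Sum>l\<in>{i}. (A ^\<^sub>m k) $$ (i, l) * A $$ (l, i))"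
    proof (intro sum.mono_neutral_right ballI)
      fix l assume "l \<in> {..<n} - {i}"
      then show "(A ^\<^sub>m k) $$ (i, l) * A $$ (l, i) = 0"
        using Suc zero that by (cases "l < i") auto
    qed (use that in auto)
    then show ?thesis using that Suc by (simp add: entry power_commutes del: pow_mat.simps)
  qed
  ultimately show ?case by (intro conjI allI impI)
qed (use A in \<open>simp add: carrier_matD\<close>)

text \<open>The sum of the absolute values of all entries dominates every column sum, so each
  multiplication costs one factor \<open>M\<close>. The exponential series is thereby majorised by
  that of \<open>exp (M * \<bar>u\<bar>)\<close>.\<close>

lemma pow_mat_entries_bound:
  assumes A: "(A :: real mat) \<in> carrier_mat n n"
  shows "\<exists>M\<ge>0. \<forall>k. \<forall>i<n. \<forall>j<n. \<bar>(A ^\<^sub>m k) $$ (i, j)\<bar> \<le> M ^ k"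
proof -
  define M where "M = (\<Sum>i<n. \<Sum>j<n. \<bar>A $$ (i, j)\<bar>)"
  have "\<forall>i<n. \<forall>j<n. \<bar>(A ^\<^sub>m k) $$ (i, j)\<bar> \<le> M ^ k" for k
  proof (induction k)
    case 0
    then show ?case using A by (auto simp: one_mat_def)
  next
    case (Suc k)
    have M0: "0 \<le> M" by (auto simp: M_def intro!: sum_nonneg)
    have "\<bar>(A ^\<^sub>m Suc k) $$ (i, j)\<bar> \<le> M ^ Suc k" if ij: "i < n" "j < n" for i j
    proof -
      have "\<bar>(A ^\<^sub>m Suc k) $$ (i, j)\<bar> \<le> (\<Sum>l<n. \<bar>(A ^\<^sub>m k) $$ (i, l) * A $$ (l, j)\<bar>)"
        using A ij index_mult_mat_sum[of "A ^\<^sub>m k" n A i j] by (simp add: sum_abs)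
      also have "\<dots> \<le> (\<Sum>l<n. M ^ k * \<bar>A $$ (l, j)\<bar>)"
        unfolding abs_mult using Suc ij by (intro sum_mono mult_right_mono) auto
      also have "\<dots> = M ^ k * (\<Sum>l<n. \<bar>A $$ (l, j)\<bar>)" by (simp add: sum_distrib_left)
      also have "\<dots> \<le> M ^ k * M"
        using ij M0
        by (intro mult_left_mono) (auto simp: M_def intro!: sum_mono member_le_sum)
      finally show ?thesis by (simp add: mult.commute)
    qed
    then show ?case by blast
  qed
  moreover have "0 \<le> M" by (auto simp: M_def intro!: sum_nonneg)
  ultimately show ?thesis by blast
qed

text \<open>Read as power series in \<open>u\<close>, the entries come within reach of the
  continuity and Cauchy product theorems for scalar series.\<close>

lemma mat_exp_smult_entry:
  assumes A: "A \<in> carrier_mat n n" and ij: "i < n" "j < n"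
  shows "mat_exp (u \<cdot>\<^sub>m A) $$ (i, j) = (\<Sum>k. (A ^\<^sub>m k) $$ (i, j) / fact k * u ^ k)"
proof -
  have "((u \<cdot>\<^sub>m A) ^\<^sub>m k) $$ (i, j) = u ^ k * (A ^\<^sub>m k) $$ (i, j)" for k
    using A ij smult_pow_mat[OF A, of u k] pow_carrier_mat[OF A, of k] by auto
  then show ?thesis using A ij by (simp add: mat_exp_def mult.commute)
qed

lemma mat_exp_series_summable:
  assumes A: "(A :: real mat) \<in> carrier_mat n n" and ij: "i < n" "j < n"
  shows "summable (\<lambda>k. \<bar>(A ^\<^sub>m k) $$ (i, j) / fact k * u ^ k\<bar>)"
proof -
  obtain M where "M \<ge> 0" and M: "\<And>k. \<bar>(A ^\<^sub>m k) $$ (i, j)\<bar> \<le> M ^ k"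
    using pow_mat_entries_bound[OF A] ij by blast
  show ?thesis
  proof (rule summable_comparison_test')
    show "summable (\<lambda>k. (M * \<bar>u\<bar>) ^ k /\<^sub>R fact k)" by (rule summable_exp_generic)
    fix k
    have "\<bar>(A ^\<^sub>m k) $$ (i, j)\<bar> * \<bar>u\<bar> ^ k \<le> M ^ k * \<bar>u\<bar> ^ k"
      using M by (intro mult_right_mono) auto
    then show "norm \<bar>(A ^\<^sub>m k) $$ (i, j) / fact k * u ^ k\<bar> \<le> (M * \<bar>u\<bar>) ^ k /\<^sub>R fact k"
      by (simp add: abs_mult power_abs power_mult_distrib divide_simps)
  qed
qed

lemma mat_exp_smult_continuous:
  assumes A: "A \<in> carrier_mat n n" and ij: "i < n" "j < n"
  shows "continuous_on UNIV (\<lambda>u. mat_exp (u \<cdot>\<^sub>m A) $$ (i, j))"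
  unfolding mat_exp_smult_entry[OF assms]
  by (intro continuous_at_imp_continuous_on ballI isCont_powser_converges_everywhere)
     (rule summable_rabs_cancel[OF mat_exp_series_summable[OF assms]])

text \<open>Each product on the right is a Cauchy product of absolutely convergent series. Summing
  over \<open>l\<close> turns the matrix entries into those of
  \<open>A ^\<^sub>m m * A ^\<^sub>m (k - m) = A ^\<^sub>m k\<close>, and the binomial theorem
  collects the scalars.\<close>

lemma mat_exp_smult_add:
  assumes A: "A \<in> carrier_mat n n" and ij: "i < n" "j < n"
  shows "mat_exp ((u + v) \<cdot>\<^sub>m A) $$ (i, j) =
    (\<Sum>l<n. mat_exp (u \<cdot>\<^sub>m A) $$ (i, l) * mat_exp (v \<cdot>\<^sub>m A) $$ (l, j))"
proof -
  define a where "a l k = (A ^\<^sub>m k) $$ (i, l) / fact k * u ^ k" for l k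
  define b where "b l k = (A ^\<^sub>m k) $$ (l, j) / fact k * v ^ k" for l k
  have "(\<lambda>k. \<Sum>m\<le>k. a l m * b l (k - m)) sums ((\<Sum>k. a l k) * (\<Sum>k. b l k))" if "l < n" for l
    unfolding a_def b_def using that
    by (intro Cauchy_product_sums; unfold real_norm_def; intro mat_exp_series_summable[OF A] ij)
  then have "(\<lambda>k. \<Sum>l<n. \<Sum>m\<le>k. a l m * b l (k - m)) sums (\<Sum>l<n. (\<Sum>k. a l k) * (\<Sum>k. b l k))"
    by (intro sums_sum) auto
  moreover have "(\<Sum>l<n. \<Sum>m\<le>k. a l m * b l (k - m)) = (A ^\<^sub>m k) $$ (i, j) / fact k * (u + v) ^ k" for k
  proof -
    have "(\<Sum>l<n. \<Sum>m\<le>k. a l m * b l (k - m)) = (\<Sum>m\<le>k. \<Sum>l<n. a l m * b l (k - m))"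
      by (rule sum.swap)
    also have "\<dots> = (\<Sum>m\<le>k. (A ^\<^sub>m k) $$ (i, j) / fact k * (of_nat (k choose m) * u ^ m * v ^ (k - m)))"
    proof (intro sum.cong refl)
      fix m assume "m \<in> {..k}"
      then have m: "m \<le> k" by simp
      have "(A ^\<^sub>m k) $$ (i, j) = (\<Sum>l<n. (A ^\<^sub>m m) $$ (i, l) * (A ^\<^sub>m (k - m)) $$ (l, j))"
        using pow_mat_add[OF A, of m "k - m"] m A ij
          index_mult_mat_sum[of "A ^\<^sub>m m" n "A ^\<^sub>m (k - m)" i j] by simp
      moreover have "(\<Sum>l<n. a l m * b l (k - m)) = (\<Sum>l<n. (A ^\<^sub>m m) $$ (i, l) * (A ^\<^sub>m (k - m)) $$ (l, j))
          * (u ^ m * v ^ (k - m) / (fact m * fact (k - m)))"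
        by (simp add: a_def b_def sum_distrib_right sum_distrib_left mult_ac)
      ultimately show "(\<Sum>l<n. a l m * b l (k - m)) =
          (A ^\<^sub>m k) $$ (i, j) / fact k * (of_nat (k choose m) * u ^ m * v ^ (k - m))"
        using m by (simp add: binomial_fact)
    qed
    also have "\<dots> = (A ^\<^sub>m k) $$ (i, j) / fact k * (u + v) ^ k"
      by (simp add: binomial_ring sum_distrib_left)
    finally show ?thesis .
  qed
  ultimately have "(\<lambda>k. (A ^\<^sub>m k) $$ (i, j) / fact k * (u + v) ^ k) sums (\<Sum>l<n. (\<Sum>k. a l k) * (\<Sum>k. b l k))"
    by simp
  then show ?thesis
    using ij by (simp add: mat_exp_smult_entry[OF A] a_def b_def sums_iff)
qed

lemma mat_exp_smult_upper_triangular: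
  assumes "A \<in> carrier_mat n n" "upper_triangular A" "j < i" "i < n"
  shows "mat_exp (u \<cdot>\<^sub>m A) $$ (i, j) = 0"
  using assms pow_mat_upper_triangular[OF assms(1,2)] by (simp add: mat_exp_smult_entry)

lemma mat_exp_smult_diag:
  assumes "A \<in> carrier_mat n n" "upper_triangular A" "i < n"
  shows "mat_exp (u \<cdot>\<^sub>m A) $$ (i, i) = exp (A $$ (i, i) * u)"
proof -
  have "(A ^\<^sub>m k) $$ (i, i) / fact k * u ^ k = (A $$ (i, i) * u) ^ k /\<^sub>R fact k" for k
    using assms pow_mat_upper_triangular[OF assms(1,2), of k]
    by (simp add: power_mult_distrib divide_inverse mult_ac)
  then show ?thesis
    unfolding mat_exp_smult_entry[OF assms(1,3,3)] exp_def by presburger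
qed

lemma mat_exp_smult_0:
  assumes "A \<in> carrier_mat n n" "i < n" "j < n"
  shows "mat_exp (0 \<cdot>\<^sub>m A) $$ (i, j) = (if i = j then 1 else 0)"
  unfolding mat_exp_smult_entry[OF assms] powser_zero using assms by simp

section \<open>Limit functions in the logarithmic variable\<close>

lemma scalar_powr_mat_exp: "scalar_powr_mat (exp u) B = mat_exp (u \<cdot>\<^sub>m B)"
  by (simp add: scalar_powr_mat_def)

lemma limit_functions_entry:
  assumes "B \<in> carrier_mat n n" "c \<in> carrier_mat 1 n" "j < n"
  shows "limit_functions B c x $$ (0, j) =
    (\<Sum>l<n. c $$ (0, l) * (LBINT y=ereal 1..ereal x. scalar_powr_mat y B $$ (l, j) * inverse y))"
  using assms by (auto simp: limit_functions_def scalar_prod_def lessThan_atLeast0 intro!: sum.cong)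

text \<open>In the chain rule the inner derivative \<open>exp u\<close> cancels the factor
  \<open>inverse y\<close> of the integrand at \<open>y = exp u\<close>.\<close>

lemma interval_integral_power_derivative:
  assumes B: "B \<in> carrier_mat n n" and ij: "i < n" "j < n"
  shows "((\<lambda>u. LBINT y=ereal 1..ereal (exp u). scalar_powr_mat y B $$ (i, j) * inverse y)
    has_real_derivative mat_exp (u \<cdot>\<^sub>m B) $$ (i, j)) (at u)"
proof -
  define \<phi> where "\<phi> y = scalar_powr_mat y B $$ (i, j) * inverse y" for y
  \<comment> \<open>The interval \<open>{a..b}\<close> lies in the positive reals and has both 1 and
    \<open>exp u\<close> in its interior, so the one-sided form of the fundamental theorem yields a
    full derivative.\<close>
  define a where "a = min 1 (exp u) / 2"
  define b where "b = max 1 (exp u) + 1"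
  have ab: "0 < a" "a < 1" "1 < b" "a < exp u" "exp u < b"
    using exp_gt_zero[of u] unfolding a_def b_def by linarith+
  have "continuous_on {a..b} (\<lambda>y. mat_exp (ln y \<cdot>\<^sub>m B) $$ (i, j))"
    using ab by (intro continuous_on_compose2[OF mat_exp_smult_continuous[OF B ij]] continuous_intros) auto
  then have "continuous_on {a..b} \<phi>"
    unfolding \<phi>_def scalar_powr_mat_def using ab by (intro continuous_intros) auto
  then have "((\<lambda>x. LBINT y=1..x. \<phi> y) has_vector_derivative \<phi> (exp u)) (at (exp u) within {a..b})"
    using interval_integral_FTC2[of a 1 b \<phi> "exp u"] ab by (simp add: one_ereal_def)
  moreover have "at (exp u) within {a..b} = at (exp u)"
    using ab by (intro at_within_interior) auto
  ultimately have "((\<lambda>x. LBINT y=1..x. \<phi> y) has_real_derivative \<phi> (exp u)) (at (exp u))"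
    by (simp add: has_real_derivative_iff_has_vector_derivative)
  from DERIV_chain2[OF this DERIV_exp]
  have "((\<lambda>u. LBINT y=1..exp u. \<phi> y) has_real_derivative \<phi> (exp u) * exp u) (at u)" .
  moreover have "\<phi> (exp u) * exp u = mat_exp (u \<cdot>\<^sub>m B) $$ (i, j)"
    by (simp add: \<phi>_def scalar_powr_mat_exp)
  ultimately show ?thesis by (simp add: \<phi>_def one_ereal_def)
qed

lemma limit_functions_derivative:
  assumes B: "B \<in> carrier_mat n n" and c: "c \<in> carrier_mat 1 n" and j: "j < n"
  shows "((\<lambda>u. limit_functions B c (exp u) $$ (0, j))
    has_real_derivative (\<Sum>l<n. c $$ (0, l) * mat_exp (u \<cdot>\<^sub>m B) $$ (l, j))) (at u)"
  unfolding limit_functions_entry[OF assms] using j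
  by (intro DERIV_sum DERIV_cmult interval_integral_power_derivative[OF B]) auto

text \<open>As functions of \<open>v\<close> both sides have the derivative
  \<open>c E (u + v)\<close>, and they agree at \<open>v = 0\<close> because the integral from 1 to
  1 vanishes.\<close>

lemma limit_functions_add:
  assumes B: "B \<in> carrier_mat n n" and c: "c \<in> carrier_mat 1 n" and j: "j < n"
  shows "limit_functions B c (exp (u + v)) $$ (0, j) = limit_functions B c (exp u) $$ (0, j) +
    (\<Sum>l<n. limit_functions B c (exp v) $$ (0, l) * mat_exp (u \<cdot>\<^sub>m B) $$ (l, j))"
proof -
  define h where "h u j = limit_functions B c (exp u) $$ (0, j)" for u j
  define E where "E u i j = mat_exp (u \<cdot>\<^sub>m B) $$ (i, j)" for u i j
  define \<psi> where "\<psi> v = h (u + v) j - h u j - (\<Sum>l<n. h v l * E u l j)" for v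
  have h': "((\<lambda>u. h u j) has_real_derivative (\<Sum>l<n. c $$ (0, l) * E u l j)) (at u)" if "j < n" for u j
    unfolding h_def E_def by (rule limit_functions_derivative[OF B c that])
  have "(\<psi> has_real_derivative 0) (at v)" for v
  proof -
    have 1: "((\<lambda>v. h (u + v) j) has_real_derivative (\<Sum>l<n. c $$ (0, l) * E (u + v) l j)) (at v)"
      using DERIV_chain2[OF h'[OF j] DERIV_add[OF DERIV_const DERIV_ident], of u v] by simp
    have 2: "((\<lambda>v. \<Sum>l<n. h v l * E u l j) has_real_derivative
        (\<Sum>l<n. (\<Sum>m<n. c $$ (0, m) * E v m l) * E u l j)) (at v)"
      by (intro DERIV_sum DERIV_cmult_right h') auto
    have "(\<Sum>l<n. (\<Sum>m<n. c $$ (0, m) * E v m l) * E u l j)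
        = (\<Sum>m<n. c $$ (0, m) * (\<Sum>l<n. E v m l * E u l j))"
      unfolding sum_distrib_right sum_distrib_left mult.assoc by (rule sum.swap)
    also have "\<dots> = (\<Sum>m<n. c $$ (0, m) * E (u + v) m j)"
      using j mat_exp_smult_add[OF B, of _ j v u] by (intro sum.cong) (auto simp: E_def add.commute)
    finally show ?thesis
      using DERIV_diff[OF DERIV_diff[OF 1 DERIV_const] 2] by (simp add: \<psi>_def[abs_def])
  qed
  then have "\<psi> v = \<psi> 0" by (intro DERIV_isconst_all) auto
  moreover have "h 0 l = 0" if "l < n" for l
    using that by (simp add: h_def limit_functions_entry[OF B c] one_ereal_def)
  ultimately show ?thesis by (simp add: \<psi>_def h_def E_def)
qed

section \<open>Return to the original variables\<close>

lemma smallo_exp_tendsto: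
  assumes "\<phi> \<in> o[at_top](\<psi>)"
  shows "((\<lambda>s. \<phi> (exp s) / \<psi> (exp s)) \<longlongrightarrow> (0::real)) (at_top :: real filter)"
  using filterlim_compose[OF smalloD_tendsto[OF assms] exp_at_top] .

theorem theorem4p8:
  fixes n :: nat and B c :: "real mat" and g :: "real \<Rightarrow> real vec"
    and f :: "real \<Rightarrow> real" and h :: "real \<Rightarrow> real mat" and \<epsilon> :: real
  assumes "n \<ge> 1"
    and "index_matrix n B"
    and "regularly_varying n B g"
    and "GRV n B g c f"
    and h_def: "h = limit_functions B c"
    and "\<epsilon> > 0"
  shows "\<exists>T>0. \<forall>t x. t \<ge> T \<longrightarrow>
    (x \<ge> 1 \<longrightarrow>
       \<bar>f (x * t) - f t - (h x *\<^sub>v g t) $ 0\<bar> / \<bar>g t $ (n - 1)\<bar>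
         \<le> \<epsilon> * x powr (max (B $$ (0, 0) + \<epsilon>) 0)) \<and>
    (T / t \<le> x \<and> x \<le> 1 \<longrightarrow>
       \<bar>f (x * t) - f t - (h x *\<^sub>v g t) $ 0\<bar> / \<bar>g t $ (n - 1)\<bar>
         \<le> \<epsilon> * x powr (min (B $$ (n - 1, n - 1) - \<epsilon>) 0))"
proof -
  have B: "B \<in> carrier_mat n n" "upper_triangular B"
    and antimono: "\<And>i j. i \<le> j \<Longrightarrow> j < n \<Longrightarrow> B $$ (j, j) \<le> B $$ (i, i)"
    using assms(2) by (auto simp: index_matrix_def)
  have g: "\<And>t. g t \<in> carrier_vec n" and sign: "\<And>i. i < n \<Longrightarrow> eventually_constant_sign (\<lambda>t. g t $ i)"
    and g_meas: "\<And>i. i < n \<Longrightarrow> measurable_near_infinity (\<lambda>t. g t $ i)"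
    and g_rv: "\<And>x i. x > 0 \<Longrightarrow> i < n \<Longrightarrow>
      (\<lambda>t. g (x * t) $ i - (scalar_powr_mat x B *\<^sub>v g t) $ i) \<in> o[at_top](\<lambda>t. g t $ (n - 1))"
    using assms(3) by (auto simp: regularly_varying_def rate_vector_def)
  have c: "c \<in> carrier_mat 1 n" and f_meas: "measurable_near_infinity f"
    and f_rv: "\<And>x. x > 0 \<Longrightarrow>
      (\<lambda>t. f (x * t) - f t - (limit_functions B c x *\<^sub>v g t) $ 0) \<in> o[at_top](\<lambda>t. g t $ (n - 1))"
    using assms(4) by (auto simp: GRV_def)
  define E where "E u i j = mat_exp (u \<cdot>\<^sub>m B) $$ (i, j)" for u i j
  define H where "H u j = limit_functions B c (exp u) $$ (0, j)" for u j
  have E_row: "(scalar_powr_mat (exp u) B *\<^sub>v g t) $ i = (\<Sum>j<n. E u i j * g t $ j)"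
    if "i < n" for u t i
    using that B g[of t] by (auto simp: scalar_powr_mat_exp E_def mat_exp_def scalar_prod_def
        lessThan_atLeast0 intro!: sum.cong)
  have H_row: "(limit_functions B c (exp u) *\<^sub>v g t) $ 0 = (\<Sum>j<n. H u j * g t $ j)" for u t
    using c B g[of t] by (auto simp: H_def limit_functions_def scalar_prod_def
        lessThan_atLeast0 intro!: sum.cong)
  \<comment> \<open>The substitution is \<open>t = exp s\<close>, \<open>x = exp u\<close>, so that
    \<open>x * t = exp (s + u)\<close>.\<close>
  interpret generalised_regular_variation n E H "\<lambda>i. B $$ (i, i)" "\<lambda>i s. g (exp s) $ i" "\<lambda>s. f (exp s)"
  proof
    show "E (u + v) i j = (\<Sum>l<n. E u i l * E v l j)" if "i < n" "j < n" for i j u v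
      unfolding E_def by (rule mat_exp_smult_add[OF B(1) that])
    show "E 0 i j = (if i = j then 1 else 0)" if "i < n" "j < n" for i j
      unfolding E_def by (rule mat_exp_smult_0[OF B(1) that])
    show "E u i j = 0" if "j < i" "i < n" for i j u
      unfolding E_def by (rule mat_exp_smult_upper_triangular[OF B that])
    show "E u i i = exp (B $$ (i, i) * u)" if "i < n" for i u
      unfolding E_def by (rule mat_exp_smult_diag[OF B that])
    show "continuous_on UNIV (\<lambda>u. E u i j)" if "i < n" "j < n" for i j
      unfolding E_def by (rule mat_exp_smult_continuous[OF B(1) that])
    show "H (u + v) j = H u j + (\<Sum>l<n. H v l * E u l j)" if "j < n" for j u v
      unfolding H_def E_def by (rule limit_functions_add[OF B(1) c that])
    show "continuous_on UNIV (\<lambda>u. H u j)" if "j < n" for j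
      unfolding H_def using limit_functions_derivative[OF B(1) c that]
      by (intro continuous_at_imp_continuous_on ballI) (rule DERIV_isCont)
    show "\<exists>S. \<forall>s\<ge>S. (\<lambda>v. g (exp (s + v)) $ i) \<in> borel_measurable (lebesgue_on {-2..2})" if "i < n" for i
      using measurable_near_infinity_exp_translation[OF g_meas[OF that]] .
    show "\<exists>S. \<forall>s\<ge>S. (\<lambda>v. f (exp (s + v))) \<in> borel_measurable (lebesgue_on {-2..2})"
      using measurable_near_infinity_exp_translation[OF f_meas] .
    have "eventually (\<lambda>t. g t $ (n - 1) \<noteq> 0) at_top"
      using sign[of "n - 1"] assms(1) unfolding eventually_constant_sign_def
      by (auto elim: eventually_mono)
    then show "eventually (\<lambda>s. g (exp s) $ (n - 1) \<noteq> 0) at_top"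
      using exp_at_top by (rule eventually_compose_filterlim)
    show "((\<lambda>s. (g (exp (s + u)) $ i - (\<Sum>j<n. E u i j * g (exp s) $ j)) / g (exp s) $ (n - 1)) \<longlongrightarrow> 0) at_top"
      if "i < n" for i u
      using smallo_exp_tendsto[OF g_rv[of "exp u" i]] that
      by (simp add: E_row exp_add mult.commute)
    show "((\<lambda>s. (f (exp (s + u)) - f (exp s) - (\<Sum>j<n. H u j * g (exp s) $ j)) / g (exp s) $ (n - 1)) \<longlongrightarrow> 0) at_top"
      for u
      using smallo_exp_tendsto[OF f_rv[of "exp u"]] by (simp add: H_row exp_add mult.commute)
  qed (rule assms(1))
  \<comment> \<open>The diagonal is non-increasing, so its first entry bounds all exponents.\<close>
  have up: "\<exists>S. \<forall>s x. S \<le> s \<longrightarrow> 0 \<le> x \<longrightarrow> S \<le> s + 1 * x \<longrightarrow>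
      \<bar>DF (1 * x) s\<bar> \<le> \<epsilon> * exp (x * max (B $$ (0, 0) + \<epsilon>) 0) * r s"
    by (rule potter_direction) (use antimono assms in auto)
  \<comment> \<open>Reversing the direction negates the exponents, and the largest of these comes
    from the last diagonal entry.\<close>
  have down: "\<exists>S. \<forall>s x. S \<le> s \<longrightarrow> 0 \<le> x \<longrightarrow> S \<le> s + - 1 * x \<longrightarrow>
      \<bar>DF (- 1 * x) s\<bar> \<le> \<epsilon> * exp (x * max (- B $$ (n - 1, n - 1) + \<epsilon>) 0) * r s"
    by (rule potter_direction) (use antimono[of _ "n - 1"] assms in auto)
  \<comment> \<open>Moving upwards, the condition on the endpoint follows from the one on
    \<open>s\<close>.\<close>
  obtain S1 where S1: "\<And>s x. S1 \<le> s \<Longrightarrow> 0 \<le> x \<Longrightarrow>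
      \<bar>DF x s\<bar> \<le> \<epsilon> * exp (x * max (B $$ (0, 0) + \<epsilon>) 0) * r s"
    using up by auto
  obtain S2 where "\<forall>s x. S2 \<le> s \<longrightarrow> 0 \<le> x \<longrightarrow> S2 \<le> s + - 1 * x \<longrightarrow>
      \<bar>DF (- 1 * x) s\<bar> \<le> \<epsilon> * exp (x * max (- B $$ (n - 1, n - 1) + \<epsilon>) 0) * r s"
    using down by blast
  then have S2: "\<bar>DF (- x) s\<bar> \<le> \<epsilon> * exp (x * max (- B $$ (n - 1, n - 1) + \<epsilon>) 0) * r s"
    if "S2 \<le> s" "0 \<le> x" "S2 \<le> s - x" for s x
    using that by simp
  obtain S3 where S3: "\<And>s. S3 \<le> s \<Longrightarrow> r s > 0" using r_pos by blast
  define S where "S = max S1 (max S2 S3)"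
  have quotient: "\<bar>f (x * t) - f t - (h x *\<^sub>v g t) $ 0\<bar> / \<bar>g t $ (n - 1)\<bar> = \<bar>DF (ln x) (ln t)\<bar> / r (ln t)"
    if "x > 0" "t > 0" for x t
    using that H_row[of "ln x" t] by (simp add: DF_def r_def h_def exp_add mult.commute)
  show ?thesis
  \<comment> \<open>With \<open>T = exp S\<close>, the condition \<open>t \<ge> T\<close> becomes
    \<open>S \<le> ln t\<close>, and \<open>T / t \<le> x\<close> becomes
    \<open>S \<le> ln t + ln x\<close>, the endpoint condition of the downward bound.\<close>
  proof (intro exI[of _ "exp S"] conjI allI impI)
    fix t x assume t: "t \<ge> exp S" and x: "x \<ge> (1::real)"
    then have x0: "x > 0" by simp
    have t0: "t > 0" using t by (rule less_le_trans[OF exp_gt_zero])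
    have s: "ln t \<ge> S" using t t0 by (simp add: ln_ge_iff)
    have "\<bar>DF (ln x) (ln t)\<bar> \<le> \<epsilon> * exp (ln x * max (B $$ (0, 0) + \<epsilon>) 0) * r (ln t)"
      using s x by (intro S1) (auto simp: S_def)
    moreover have "r (ln t) > 0" using s by (intro S3) (auto simp: S_def)
    ultimately show "\<bar>f (x * t) - f t - (h x *\<^sub>v g t) $ 0\<bar> / \<bar>g t $ (n - 1)\<bar>
         \<le> \<epsilon> * x powr (max (B $$ (0, 0) + \<epsilon>) 0)"
      unfolding quotient[OF x0 t0] using x0 by (simp add: powr_def pos_divide_le_eq mult.commute)
  next
    fix t x assume t: "t \<ge> exp S" and x: "exp S / t \<le> x \<and> x \<le> (1::real)"
    have t0: "t > 0" using t by (rule less_le_trans[OF exp_gt_zero])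
    have s: "ln t \<ge> S" using t t0 by (simp add: ln_ge_iff)
    have x0: "x > 0" using x t0 by (auto intro: less_le_trans[of 0 "exp S / t"])
    have "exp S \<le> x * t" using x t0 by (simp add: divide_simps)
    then have "S \<le> ln (x * t)" using x0 t0 by (simp add: ln_ge_iff)
    then have sx: "S \<le> ln t - (- ln x)" using x0 t0 by (simp add: ln_mult)
    \<comment> \<open>Two sign changes cancel: \<open>- ln x\<close> is the length of the downward
      path, and the maximum is the negative of the minimum in the claim.\<close>
    have e: "- ln x * max (- B $$ (n - 1, n - 1) + \<epsilon>) 0 = min (B $$ (n - 1, n - 1) - \<epsilon>) 0 * ln x"
      by (simp add: max_def min_def algebra_simps)
    have "\<bar>DF (- (- ln x)) (ln t)\<bar>
        \<le> \<epsilon> * exp (- ln x * max (- B $$ (n - 1, n - 1) + \<epsilon>) 0) * r (ln t)"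
      using s sx x x0 by (intro S2) (auto simp: S_def)
    then have "\<bar>DF (ln x) (ln t)\<bar> \<le> \<epsilon> * x powr (min (B $$ (n - 1, n - 1) - \<epsilon>) 0) * r (ln t)"
      unfolding e using x0 by (simp add: powr_def)
    moreover have "r (ln t) > 0" using s by (intro S3) (auto simp: S_def)
    ultimately show "\<bar>f (x * t) - f t - (h x *\<^sub>v g t) $ 0\<bar> / \<bar>g t $ (n - 1)\<bar>
         \<le> \<epsilon> * x powr (min (B $$ (n - 1, n - 1) - \<epsilon>) 0)"
      unfolding quotient[OF x0 t0] by (simp add: pos_divide_le_eq)
  qed simp
qed

end
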